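(* Let $\mathbb F$ be an algebraically closed field of characteristic zero, and let $\mathcal L$ be the Witt algebra $\mathcal W$ or the Virasoro algebra $\mathcal V$ over $\mathbb F$. Fix $n\in\mathbb Z$ and $\ell,k\in\mathbb F$ with $n\ne 1$ and $\ell,k\neq 0$, and put $$X=-\tfrac{1}{n-1}x+\ell x^n,\qquad Y=-\tfrac{k}{2(n-1)\ell}x^{-n+2}+kx-\tfrac{(n-1)\ell k}{2}x^n\ \in\ \mathcal L.$$ Let $(\mathcal L,[\cdot,\cdot],\Delta)$ be the coboundary triangular Lie bialgebra, with cobracket $\Delta(u)=u\cdot r$, associated to the solution $r=X\otimes Y-Y\otimes X$ of the classical Yang–Baxter equation. Then the dual Lie bialgebra is $(\mathcal L^\circ,[\cdot,\cdot],\Delta)$, described as follows. The underlying space $\mathcal L^\circ$ is the set of all $f=\sum_{i\in\mathbb Z}f_i\varepsilon^i$ for which there are $r\in\mathbb N$ and $h_1,\dots,h_r\in\mathbb F$ with $f_m=h_1f_{m-1}+\cdots+h_rf_{m-r}$ for all $m\in\mathbb Z$. The cobracket is uniquely determined by $\Delta(\varepsilon^m)=\sum_{i+j=m+1}(j-i)\,\varepsilon^i\otimes\varepsilon^j$ for $m\in\mathbb Z$, the sum being over $i,j\in\mathbb Z$. The bracket is uniquely determined (together with skew-symmetry) by the following, for $i,j\in\mathbb Z$: - if $i=1\neq j$, $$[\varepsilon^i,\varepsilon^j]=-k(\delta_{j,n}+\delta_{j,2-n})\varepsilon^j-\tfrac{k(j+2n-3)}{2(n-1)^2\ell}\varepsilon^{j+n-1}-\tfrac{k\ell}{2}(2n-j-1)\varepsilon^{j-n+1};$$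 - if $i=2-n$ and $j\neq 1,2-n$, $$[\varepsilon^i,\varepsilon^j]=-\tfrac{k}{2}\delta_{j,n}\varepsilon^1-\tfrac{k\ell}{2}(n-1)\delta_{j,n}\varepsilon^{2-n}+\tfrac{k(j-1)}{2(n-1)^2\ell}\varepsilon^j+\tfrac{k(2n-j-1)}{2(n-1)}\varepsilon^{j-(n-1)};$$ - if $i=n$ and $j\ne 1,2-n,n$, $$[\varepsilon^i,\varepsilon^j]=\tfrac{k(j+2n-3)}{2(n-1)}\varepsilon^{j+n-1}+\tfrac{k\ell}{2}(1-j)\varepsilon^j;$$ - if $i,j\notin\{1,2-n,n\}$, $[\varepsilon^i,\varepsilon^j]=0$.
   Context: $\mathbb N$ denotes the positive integers. Algebras. $\mathcal W$ is the Lie algebra on the space $\mathbb F[x,x^{-1}]$ with bracket $[a,b]=a\,\frac{db}{dx}-\frac{da}{dx}\,b$, i.e. $[x^i,x^j]=(j-i)x^{i+j-1}$. $\mathcal V$ is the universal central extension of $\mathcal W$, with basis $\{x^{m+1},c\mid m\in\mathbb Z\}$, $c$ central and $[x^{m+1},x^{n+1}]=(n-m)x^{m+n+1}+\frac{m^3-m}{12}\delta_{m+n,0}\,c$. Lie bialgebras. A Lie bialgebra is a triple $(L,[\cdot,\cdot],\delta)$ with $(L,[\cdot,\cdot])$ a Lie algebra, $(L,\delta)$ a Lie coalgebra, and $\delta[u,v]=u\cdot\delta(v)-v\cdot\delta(u)$, where $u\cdot(v\otimes w)=[u,v]\otimes w+v\otimes[u,w]$. It is coboundary if $\delta(u)=u\cdot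 r$ for some $r\in L\otimes L$, and triangular if moreover $r$ satisfies the classical Yang–Baxter equation $[r_{12},r_{13}]+[r_{12},r_{23}]+[r_{13},r_{23}]=0$ in $U(L)^{\otimes 3}$, where $r_{12}=r\otimes 1$, $r_{23}=1\otimes r$, and $r_{13}$ has the two legs of $r$ in positions 1 and 3. Duals. For a Lie algebra $\mathfrak g$ with bracket $\varphi:\mathfrak g\otimes\mathfrak g\to\mathfrak g$, a subspace $V\subseteq\mathfrak g^*$ is good if $\varphi^*(V)\subseteq V\otimes V$ (with $\mathfrak g^*\otimes\mathfrak g^*\subseteq(\mathfrak g\otimes\mathfrak g)^*$ in the natural way), and $\mathfrak g^\circ$ is the sum of all good subspaces, which is the maximal good subspace; it is a Lie coalgebra with cobracket $\varphi^\circ=\varphi^*|_{\mathfrak g^\circ}$. If $(\mathfrak g,\varphi,\delta)$ is a Lie bialgebra, then $\delta^*$ restricts to a Lie bracket $\delta^\circ:\mathfrak g^\circ\otimes\mathfrak g^\circ\to\mathfrak g^\circ$, $\delta^\circ(f\otimes g)(u)=(f\otimes g)(\delta(u))$, and $(\mathfrak g^\circ,\delta^\circ,\varphi^\circ)$ is called the dual Lie bialgebra; its bracket and cobracket are again denoted $[\cdot,\cdot]$ and $\Delta$. Dual elements. For $i\in\mathbb Z$, $\varepsilon^i$ is the linear functional with $\varepsilon^i(x^j)=\delta_{i,j}$ for $j\in\mathbb Z$, and $\varepsilon^i(c)=0$ in the case of $\mathcal V$. A possibly infinite sum $f=\sum_i f_i\varepsilon^i$ denotes the functional with $f(x^j)=f_j$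 (and $f(c)=0$ for $\mathcal V$). Infinite sums of the $\varepsilon^i\otimes\varepsilon^j$ are read as elements of $(\mathcal L\otimes\mathcal L)^*$. "Uniquely determined" means extension to infinite sums by evaluation: for $f=\sum_i f_i\varepsilon^i$, $g=\sum_j g_j\varepsilon^j$ in $\mathcal L^\circ$, one has $\Delta(f)=\sum_i f_i\Delta(\varepsilon^i)$ and $[f,g]=\sum_{i,j}f_ig_j[\varepsilon^i,\varepsilon^j]$, where on each basis element of $\mathcal L\otimes\mathcal L$ (respectively $\mathcal L$) only finitely many terms contribute. The individual $\varepsilon^i$ do not lie in $\mathcal L^\circ$.
   Formalization: For the Virasoro algebra, r solves the classical Yang–Baxter equation only if n = 0 or 2, as [X,Y] = Y − (k n(n−2)/24)c; triangularity there is claimed only for these n, while the description of the dual is proved for all n ≠ 1. *)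

theory Defs
  imports
    Complex_Main
    "HOL-Library.Poly_Mapping"
    "HOL-Library.Function_Algebras"
    "HOL-Library.Product_Plus"
    "HOL-Computational_Algebra.Polynomial"
begin

section \<open>Tensors over a subspace\<close>

text \<open>
  Everything below concerns a subspace \<open>S\<close> of a vector space with scalar multiplication \<open>s\<close>.
  The tensor product of \<open>S\<close> with itself is realised inside the dual of the space of bilinear
  forms on \<open>S\<close>: the pure tensor of \<open>a\<close> and \<open>b\<close> is evaluation at \<open>(a, b)\<close>. Over a field this is
  faithful, because bilinear forms separate tensors. A tensor is given the value 0 on functions
  that are not bilinear on \<open>S\<close>, so that equality of tensors is equality of functions.
\<close>

type_synonym ('f, 'v) tensor = "('v \<Rightarrow> 'v \<Rightarrow> 'f) \<Rightarrow> 'f"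

definition bilinear_on ::
  "('f::field \<Rightarrow> 'v::ab_group_add \<Rightarrow> 'v) \<Rightarrow> 'v set \<Rightarrow> ('f \<Rightarrow> 'w::ab_group_add \<Rightarrow> 'w)
    \<Rightarrow> ('v \<Rightarrow> 'v \<Rightarrow> 'w) \<Rightarrow> bool" where
  "bilinear_on s S s' B \<longleftrightarrow>
     (\<forall>a\<in>S. \<forall>b\<in>S. \<forall>c\<in>S. B (a + b) c = B a c + B b c \<and> B c (a + b) = B c a + B c b) \<and>
     (\<forall>t. \<forall>a\<in>S. \<forall>b\<in>S. B (s t a) b = s' t (B a b) \<and> B a (s t b) = s' t (B a b))"

definition bilinear_form_on ::
  "('f::field \<Rightarrow> 'v::ab_group_add \<Rightarrow> 'v) \<Rightarrow> 'v set \<Rightarrow> ('v \<Rightarrow> 'v \<Rightarrow> 'f) \<Rightarrow> bool" where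
  "bilinear_form_on s S B \<longleftrightarrow> bilinear_on s S (*) B"

definition trilinear_form_on ::
  "('f::field \<Rightarrow> 'v::ab_group_add \<Rightarrow> 'v) \<Rightarrow> 'v set \<Rightarrow> ('v \<Rightarrow> 'v \<Rightarrow> 'v \<Rightarrow> 'f) \<Rightarrow> bool" where
  "trilinear_form_on s S M \<longleftrightarrow>
     (\<forall>c\<in>S. bilinear_form_on s S (\<lambda>a b. M a b c)) \<and>
     (\<forall>a\<in>S. bilinear_form_on s S (\<lambda>b c. M a b c))"

definition fscale :: "'f::field \<Rightarrow> ('x \<Rightarrow> 'f) \<Rightarrow> 'x \<Rightarrow> 'f" where
  "fscale c f = (\<lambda>x. c * f x)"

definition pure_tensor ::
  "('f::field \<Rightarrow> 'v::ab_group_add \<Rightarrow> 'v) \<Rightarrow> 'v set \<Rightarrow> 'v \<Rightarrow> 'v \<Rightarrow> ('f, 'v) tensor" where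
  "pure_tensor s S a b = (\<lambda>B. if bilinear_form_on s S B then B a b else 0)"

definition tensor_square ::
  "('f::field \<Rightarrow> 'v::ab_group_add \<Rightarrow> 'v) \<Rightarrow> 'v set \<Rightarrow> ('f, 'v) tensor set" where
  "tensor_square s S = module.span fscale {pure_tensor s S a b | a b. a \<in> S \<and> b \<in> S}"

definition tensor_flip :: "('f, 'v) tensor \<Rightarrow> ('f, 'v) tensor" where
  "tensor_flip T = (\<lambda>B. T (\<lambda>a b. B b a))"

text \<open>The action \<open>u \<cdot> (a \<otimes> b) = [u, a] \<otimes> b + a \<otimes> [u, b]\<close>.\<close>

definition tensor_act ::
  "('f::field \<Rightarrow> 'v::ab_group_add \<Rightarrow> 'v) \<Rightarrow> 'v set \<Rightarrow> ('v \<Rightarrow> 'v \<Rightarrow> 'v)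
    \<Rightarrow> 'v \<Rightarrow> ('f, 'v) tensor \<Rightarrow> ('f, 'v) tensor" where
  "tensor_act s S br u T =
     (\<lambda>B. if bilinear_form_on s S B then T (\<lambda>a b. B (br u a) b + B a (br u b)) else 0)"


section \<open>Lie algebras, Lie coalgebras, Lie bialgebras\<close>

definition lie_algebra ::
  "('f::field \<Rightarrow> 'v::ab_group_add \<Rightarrow> 'v) \<Rightarrow> 'v set \<Rightarrow> ('v \<Rightarrow> 'v \<Rightarrow> 'v) \<Rightarrow> bool" where
  "lie_algebra s S br \<longleftrightarrow>
     vector_space s \<and> module.subspace s S \<and>
     (\<forall>a\<in>S. \<forall>b\<in>S. br a b \<in> S) \<and>
     bilinear_on s S s br \<and>
     (\<forall>a\<in>S. br a a = 0) \<and>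
     (\<forall>a\<in>S. \<forall>b\<in>S. \<forall>c\<in>S. br a (br b c) + br b (br c a) + br c (br a b) = 0)"

text \<open>
  Applied to a trilinear form \<open>M\<close>, the tensor \<open>(1 \<otimes> \<delta>)(\<delta> a)\<close> is
  \<open>\<delta> a (\<lambda>b c. \<delta> c (\<lambda>d e. M b d e))\<close>; the last clause is the co-Jacobi identity
  \<open>(1 + \<xi> + \<xi>\<^sup>2)(1 \<otimes> \<delta>)\<delta> = 0\<close>, where \<open>\<xi>\<close> is the cyclic permutation of three factors.
\<close>

definition lie_coalgebra ::
  "('f::field \<Rightarrow> 'v::ab_group_add \<Rightarrow> 'v) \<Rightarrow> 'v set \<Rightarrow> ('v \<Rightarrow> ('f, 'v) tensor) \<Rightarrow> bool" where
  "lie_coalgebra s S \<delta> \<longleftrightarrow>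
     vector_space s \<and> module.subspace s S \<and>
     (\<forall>a\<in>S. \<delta> a \<in> tensor_square s S) \<and>
     (\<forall>a\<in>S. \<forall>b\<in>S. \<delta> (a + b) = \<delta> a + \<delta> b) \<and>
     (\<forall>t. \<forall>a\<in>S. \<delta> (s t a) = fscale t (\<delta> a)) \<and>
     (\<forall>a\<in>S. tensor_flip (\<delta> a) = - \<delta> a) \<and>
     (\<forall>a\<in>S. \<forall>M. trilinear_form_on s S M \<longrightarrow>
        \<delta> a (\<lambda>b c. \<delta> c (\<lambda>d e. M b d e + M d e b + M e b d)) = 0)"

definition lie_bialgebra ::
  "('f::field \<Rightarrow> 'v::ab_group_add \<Rightarrow> 'v) \<Rightarrow> 'v set \<Rightarrow> ('v \<Rightarrow> 'v \<Rightarrow> 'v)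
    \<Rightarrow> ('v \<Rightarrow> ('f, 'v) tensor) \<Rightarrow> bool" where
  "lie_bialgebra s S br \<delta> \<longleftrightarrow>
     lie_algebra s S br \<and> lie_coalgebra s S \<delta> \<and>
     (\<forall>u\<in>S. \<forall>v\<in>S. \<delta> (br u v) = tensor_act s S br u (\<delta> v) - tensor_act s S br v (\<delta> u))"

text \<open>
  With \<open>r = \<Sum> a \<otimes> b = \<Sum> c \<otimes> d\<close>, the three summands are \<open>[r\<^sub>1\<^sub>2, r\<^sub>1\<^sub>3]\<close>, \<open>[r\<^sub>1\<^sub>2, r\<^sub>2\<^sub>3]\<close> and
  \<open>[r\<^sub>1\<^sub>3, r\<^sub>2\<^sub>3]\<close>. They lie in the third tensor power of the Lie algebra, which embeds into that
  of its enveloping algebra.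
\<close>

definition cybe ::
  "('f::field \<Rightarrow> 'v::ab_group_add \<Rightarrow> 'v) \<Rightarrow> 'v set \<Rightarrow> ('v \<Rightarrow> 'v \<Rightarrow> 'v) \<Rightarrow> ('f, 'v) tensor \<Rightarrow> bool" where
  "cybe s S br r \<longleftrightarrow>
     (\<forall>M. trilinear_form_on s S M \<longrightarrow>
        r (\<lambda>a b. r (\<lambda>c d. M (br a c) b d + M a (br b c) d + M a c (br b d))) = 0)"

definition coboundary_lie_bialgebra ::
  "('f::field \<Rightarrow> 'v::ab_group_add \<Rightarrow> 'v) \<Rightarrow> 'v set \<Rightarrow> ('v \<Rightarrow> 'v \<Rightarrow> 'v)
    \<Rightarrow> ('v \<Rightarrow> ('f, 'v) tensor) \<Rightarrow> ('f, 'v) tensor \<Rightarrow> bool" where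
  "coboundary_lie_bialgebra s S br \<delta> r \<longleftrightarrow>
     lie_bialgebra s S br \<delta> \<and> r \<in> tensor_square s S \<and> (\<forall>u\<in>S. \<delta> u = tensor_act s S br u r)"

definition triangular_lie_bialgebra ::
  "('f::field \<Rightarrow> 'v::ab_group_add \<Rightarrow> 'v) \<Rightarrow> 'v set \<Rightarrow> ('v \<Rightarrow> 'v \<Rightarrow> 'v)
    \<Rightarrow> ('v \<Rightarrow> ('f, 'v) tensor) \<Rightarrow> ('f, 'v) tensor \<Rightarrow> bool" where
  "triangular_lie_bialgebra s S br \<delta> r \<longleftrightarrow> coboundary_lie_bialgebra s S br \<delta> r \<and> cybe s S br r"


section \<open>The dual Lie bialgebra\<close>

definition full_dual :: "('f::field \<Rightarrow> 'v::ab_group_add \<Rightarrow> 'v) \<Rightarrow> ('v \<Rightarrow> 'f) set" where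
  "full_dual s = {f. Vector_Spaces.linear s (*) f}"

text \<open>
  \<open>(\<gg> \<otimes> \<gg>)\<^sup>*\<close> is identified with the space of bilinear forms on \<open>\<gg>\<close>; \<open>form_square V\<close> is
  the image of \<open>V \<otimes> V\<close> in it.
\<close>

definition form_square :: "('v \<Rightarrow> 'f::field) set \<Rightarrow> ('v \<Rightarrow> 'v \<Rightarrow> 'f) set" where
  "form_square V = module.span (\<lambda>c B u v. c * B u v) {\<lambda>u v. f u * g v | f g. f \<in> V \<and> g \<in> V}"

definition bracket_transpose :: "('v \<Rightarrow> 'v \<Rightarrow> 'v) \<Rightarrow> ('v \<Rightarrow> 'f) \<Rightarrow> 'v \<Rightarrow> 'v \<Rightarrow> 'f" where
  "bracket_transpose br f = (\<lambda>u v. f (br u v))"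

definition good_subspace ::
  "('f::field \<Rightarrow> 'v::ab_group_add \<Rightarrow> 'v) \<Rightarrow> ('v \<Rightarrow> 'v \<Rightarrow> 'v) \<Rightarrow> ('v \<Rightarrow> 'f) set \<Rightarrow> bool" where
  "good_subspace s br V \<longleftrightarrow>
     V \<subseteq> full_dual s \<and> module.subspace fscale V \<and>
     (\<forall>f\<in>V. bracket_transpose br f \<in> form_square V)"

definition lie_dual ::
  "('f::field \<Rightarrow> 'v::ab_group_add \<Rightarrow> 'v) \<Rightarrow> ('v \<Rightarrow> 'v \<Rightarrow> 'v) \<Rightarrow> ('v \<Rightarrow> 'f) set" where
  "lie_dual s br = module.span fscale (\<Union> {V. good_subspace s br V})"

definition dual_bracket :: "('v \<Rightarrow> ('f::field, 'v) tensor) \<Rightarrow> ('v \<Rightarrow> 'f) \<Rightarrow> ('v \<Rightarrow> 'f) \<Rightarrow> 'v \<Rightarrow> 'f" where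
  "dual_bracket \<delta> f g = (\<lambda>u. \<delta> u (\<lambda>a b. f a * g b))"

text \<open>
  The natural embedding \<open>V \<otimes> V \<subseteq> (\<gg> \<otimes> \<gg>)\<^sup>*\<close> for \<open>V \<subseteq> \<gg>\<^sup>*\<close>: it sends \<open>f \<otimes> g\<close> to
  \<open>\<lambda>u v. f u * g v\<close>.
\<close>

definition tensor_to_form :: "('f::field, 'v \<Rightarrow> 'f) tensor \<Rightarrow> 'v \<Rightarrow> 'v \<Rightarrow> 'f" where
  "tensor_to_form T = (\<lambda>u v. T (\<lambda>f g. f u * g v))"

definition dual_cobracket ::
  "('f::field \<Rightarrow> 'v::ab_group_add \<Rightarrow> 'v) \<Rightarrow> ('v \<Rightarrow> 'v \<Rightarrow> 'v) \<Rightarrow> ('v \<Rightarrow> 'f) \<Rightarrow> ('f, 'v \<Rightarrow> 'f) tensor" where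
  "dual_cobracket s br f =
     (THE T. T \<in> tensor_square fscale (lie_dual s br) \<and> tensor_to_form T = bracket_transpose br f)"


section \<open>The Witt algebra\<close>

text \<open>Laurent polynomials; the library multiplication on this type is the usual one.\<close>

type_synonym 'f witt = "int \<Rightarrow>\<^sub>0 'f"

definition witt_scale :: "'f::field \<Rightarrow> 'f witt \<Rightarrow> 'f witt" where
  "witt_scale t p = Poly_Mapping.map ((*) t) p"

definition laurent_deriv :: "'f::field witt \<Rightarrow> 'f witt" where
  "laurent_deriv p =
     (\<Sum>i\<in>Poly_Mapping.keys p. Poly_Mapping.single (i - 1) (of_int i * Poly_Mapping.lookup p i))"

definition witt_bracket :: "'f::field witt \<Rightarrow> 'f witt \<Rightarrow> 'f witt" where
  "witt_bracket a b = a * laurent_deriv b - laurent_deriv a * b"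

definition witt_x :: "int \<Rightarrow> 'f::field witt" where
  "witt_x i = Poly_Mapping.single i 1"

definition witt_eps :: "int \<Rightarrow> 'f::field witt \<Rightarrow> 'f" where
  "witt_eps i p = Poly_Mapping.lookup p i"


section \<open>The Virasoro algebra\<close>

text \<open>The pair \<open>(p, z)\<close> stands for \<open>p + z c\<close>.\<close>

type_synonym 'f virasoro = "'f witt \<times> 'f"

definition vir_scale :: "'f::field \<Rightarrow> 'f virasoro \<Rightarrow> 'f virasoro" where
  "vir_scale t v = (witt_scale t (fst v), t * snd v)"

text \<open>
  The cocycle pairs \<open>x\<^sup>i\<close>, \<open>i = m + 1\<close>, with \<open>x\<^sup>2\<^sup>-\<^sup>i\<close>, whose exponent is \<open>- m + 1\<close>.
\<close>

definition vir_cocycle :: "'f::field witt \<Rightarrow> 'f witt \<Rightarrow> 'f" where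
  "vir_cocycle a b =
     (\<Sum>i\<in>Poly_Mapping.keys a. Poly_Mapping.lookup a i * Poly_Mapping.lookup b (2 - i) *
        (of_int ((i - 1) ^ 3 - (i - 1)) / 12))"

definition vir_bracket :: "'f::field virasoro \<Rightarrow> 'f virasoro \<Rightarrow> 'f virasoro" where
  "vir_bracket v w = (witt_bracket (fst v) (fst w), vir_cocycle (fst v) (fst w))"

definition vir_x :: "int \<Rightarrow> 'f::field virasoro" where
  "vir_x i = (witt_x i, 0)"

definition vir_eps :: "int \<Rightarrow> 'f::field virasoro \<Rightarrow> 'f" where
  "vir_eps i v = witt_eps i (fst v)"


section \<open>The r-matrix\<close>

definition elem_X :: "('f::field \<Rightarrow> 'v::ab_group_add \<Rightarrow> 'v) \<Rightarrow> (int \<Rightarrow> 'v) \<Rightarrow> int \<Rightarrow> 'f \<Rightarrow> 'v" where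
  "elem_X s x n l = s (- (1 / (of_int n - 1))) (x 1) + s l (x n)"

definition elem_Y :: "('f::field \<Rightarrow> 'v::ab_group_add \<Rightarrow> 'v) \<Rightarrow> (int \<Rightarrow> 'v) \<Rightarrow> int \<Rightarrow> 'f \<Rightarrow> 'f \<Rightarrow> 'v" where
  "elem_Y s x n l k =
     s (- (k / (2 * (of_int n - 1) * l))) (x (- n + 2)) + s k (x 1)
       + s (- ((of_int n - 1) * l * k / 2)) (x n)"

definition r_matrix ::
  "('f::field \<Rightarrow> 'v::ab_group_add \<Rightarrow> 'v) \<Rightarrow> (int \<Rightarrow> 'v) \<Rightarrow> int \<Rightarrow> 'f \<Rightarrow> 'f \<Rightarrow> ('f, 'v) tensor" where
  "r_matrix s x n l k =
     pure_tensor s UNIV (elem_X s x n l) (elem_Y s x n l k)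
       - pure_tensor s UNIV (elem_Y s x n l k) (elem_X s x n l)"

definition witt_delta :: "int \<Rightarrow> 'f::field \<Rightarrow> 'f \<Rightarrow> 'f witt \<Rightarrow> ('f, 'f witt) tensor" where
  "witt_delta n l k =
     (\<lambda>u. tensor_act witt_scale UNIV witt_bracket u (r_matrix witt_scale witt_x n l k))"

definition vir_delta :: "int \<Rightarrow> 'f::field \<Rightarrow> 'f \<Rightarrow> 'f virasoro \<Rightarrow> ('f, 'f virasoro) tensor" where
  "vir_delta n l k =
     (\<lambda>u. tensor_act vir_scale UNIV vir_bracket u (r_matrix vir_scale vir_x n l k))"


section \<open>Sequences and infinite sums of dual elements\<close>

definition linearly_recursive :: "(int \<Rightarrow> 'f::field) \<Rightarrow> bool" where
  "linearly_recursive a \<longleftrightarrow>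
     (\<exists>(r::nat) (h::nat \<Rightarrow> 'f). r \<ge> 1 \<and> (\<forall>m. a m = (\<Sum>i=1..r. h i * a (m - int i))))"

text \<open>
  \<open>Sum_any\<close> is the sum over the support, so an infinite sum of functionals is evaluated pointwise
  as long as the support is finite at each point.
\<close>

definition eps_sum :: "(int \<Rightarrow> 'v \<Rightarrow> 'f::field) \<Rightarrow> (int \<Rightarrow> 'f) \<Rightarrow> 'v \<Rightarrow> 'f" where
  "eps_sum eps a = (\<lambda>v. Sum_any (\<lambda>i. a i * eps i v))"

text \<open>\<open>\<Delta>(\<epsilon>\<^sup>m)\<close> as an element of \<open>(L \<otimes> L)\<^sup>*\<close>, the sum being over pairs with \<open>i + j = m + 1\<close>.\<close>

definition eps_cobracket :: "(int \<Rightarrow> 'v \<Rightarrow> 'f::field) \<Rightarrow> int \<Rightarrow> 'v \<Rightarrow> 'v \<Rightarrow> 'f" where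
  "eps_cobracket eps m =
     (\<lambda>u v. Sum_any (\<lambda>(i, j). if i + j = m + 1 then of_int (j - i) * (eps i u * eps j v) else 0))"

definition eps_bracket_table ::
  "(int \<Rightarrow> 'v \<Rightarrow> 'f::field) \<Rightarrow> int \<Rightarrow> 'f \<Rightarrow> 'f \<Rightarrow> (int \<Rightarrow> int \<Rightarrow> 'v \<Rightarrow> 'f) \<Rightarrow> bool" where
  "eps_bracket_table eps n l k E \<longleftrightarrow>
     (\<forall>i j. E i j = - E j i) \<and>
     (\<forall>j. j \<noteq> 1 \<longrightarrow>
        E 1 j = fscale (- k * (of_bool (j = n) + of_bool (j = 2 - n))) (eps j)
          - fscale (k * of_int (j + 2 * n - 3) / (2 * (of_int n - 1) ^ 2 * l)) (eps (j + n - 1))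
          - fscale (k * l / 2 * of_int (2 * n - j - 1)) (eps (j - n + 1))) \<and>
     (\<forall>j. j \<notin> {1, 2 - n} \<longrightarrow>
        E (2 - n) j = - fscale (k / 2 * of_bool (j = n)) (eps 1)
          - fscale (k * l / 2 * (of_int n - 1) * of_bool (j = n)) (eps (2 - n))
          + fscale (k * of_int (j - 1) / (2 * (of_int n - 1) ^ 2 * l)) (eps j)
          + fscale (k * of_int (2 * n - j - 1) / (2 * (of_int n - 1))) (eps (j - (n - 1)))) \<and>
     (\<forall>j. j \<notin> {1, 2 - n, n} \<longrightarrow>
        E n j = fscale (k * of_int (j + 2 * n - 3) / (2 * (of_int n - 1))) (eps (j + n - 1))
          + fscale (k * l / 2 * of_int (1 - j)) (eps j)) \<and>
     (\<forall>i j. i \<notin> {1, 2 - n, n} \<and> j \<notin> {1, 2 - n, n} \<longrightarrow> E i j = 0)"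

text \<open>
  The \<open>\<epsilon>\<^sup>i\<close> are not in the dual Lie coalgebra, so \<open>\<Delta>(\<epsilon>\<^sup>m)\<close> and \<open>[\<epsilon>\<^sup>i, \<epsilon>\<^sup>j]\<close> mean the
  transposes of the bracket and of the cobracket, which are defined on all functionals. The two
  predicates below say that these are given by the stated formulas, and that the operations on
  linearly recursive functionals arise from them by evaluation of locally finite sums.
\<close>

definition cobracket_description ::
  "('f::field \<Rightarrow> 'v::ab_group_add \<Rightarrow> 'v) \<Rightarrow> ('v \<Rightarrow> 'v \<Rightarrow> 'v) \<Rightarrow> (int \<Rightarrow> 'v \<Rightarrow> 'f) \<Rightarrow> bool" where
  "cobracket_description s br eps \<longleftrightarrow>
     (\<forall>m. bracket_transpose br (eps m) = eps_cobracket eps m) \<and>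
     (\<forall>m u v. finite {(i, j). i + j = m + 1 \<and> eps i u * eps j v \<noteq> 0}) \<and>
     (\<forall>u v. finite {m. eps_cobracket eps m u v \<noteq> 0}) \<and>
     (\<forall>a. linearly_recursive a \<longrightarrow>
        tensor_to_form (dual_cobracket s br (eps_sum eps a)) =
          (\<lambda>u v. Sum_any (\<lambda>m. a m * eps_cobracket eps m u v)))"

definition bracket_description ::
  "('v \<Rightarrow> ('f::field, 'v) tensor) \<Rightarrow> (int \<Rightarrow> 'v \<Rightarrow> 'f) \<Rightarrow> int \<Rightarrow> 'f \<Rightarrow> 'f \<Rightarrow> bool" where
  "bracket_description \<delta> eps n l k \<longleftrightarrow>
     eps_bracket_table eps n l k (\<lambda>i j. dual_bracket \<delta> (eps i) (eps j)) \<and>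
     (\<forall>u. finite {(i, j). dual_bracket \<delta> (eps i) (eps j) u \<noteq> 0}) \<and>
     (\<forall>a b. linearly_recursive a \<and> linearly_recursive b \<longrightarrow>
        dual_bracket \<delta> (eps_sum eps a) (eps_sum eps b) =
          (\<lambda>u. Sum_any (\<lambda>(i, j). a i * b j * dual_bracket \<delta> (eps i) (eps j) u)))"


section \<open>Structure constants\<close>

lemma laurent_deriv_single: "laurent_deriv (Poly_Mapping.single i t) = Poly_Mapping.single (i - 1) (of_int i * t)"
  by (cases "t = 0") (auto simp: laurent_deriv_def)

lemma witt_bracket_single:
  "witt_bracket (Poly_Mapping.single i p) (Poly_Mapping.single j q)
     = Poly_Mapping.single (i + j - 1) (of_int (j - i) * p * q)"
proof -
  have "i + (j - 1) = i + j - 1" "i - 1 + j = i + j - 1" by auto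
  then show ?thesis
    by (simp add: witt_bracket_def laurent_deriv_single mult_single single_diff [symmetric] algebra_simps)
qed

lemma witt_bracket_x: "witt_bracket (witt_x i) (witt_x j) = witt_scale (of_int (j - i)) (witt_x (i + j - 1))"
  by (simp add: witt_x_def witt_bracket_single witt_scale_def)

lemma lookup_witt_scale: "Poly_Mapping.lookup (witt_scale t p) i = t * Poly_Mapping.lookup p i"
  by (simp add: witt_scale_def Poly_Mapping.map.rep_eq when_def)

lemma witt_scale_single: "witt_scale t (Poly_Mapping.single i a) = Poly_Mapping.single i (t * a)"
  by (rule poly_mapping_eqI) (simp add: lookup_witt_scale lookup_single when_def)

lemma witt_scale_zero: "witt_scale t 0 = 0"
  by (rule poly_mapping_eqI) (simp add: lookup_witt_scale)

lemma vir_bracket_x: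
  "vir_bracket (vir_x (m + 1)) (vir_x (n + 1)) =
     vir_scale (of_int (n - m)) (vir_x (m + n + 1))
       + vir_scale (of_int (m ^ 3 - m) / 12 * of_bool (m + n = 0)) (0, 1 :: 'f::field_char_0)"
proof -
  have 1: "witt_bracket (witt_x (m + 1)) (witt_x (n + 1))
             = witt_scale (of_int (n - m) :: 'f) (witt_x (m + n + 1))"
    by (simp add: witt_bracket_x algebra_simps)
  have 2: "vir_cocycle (witt_x (m + 1)) (witt_x (n + 1) :: 'f witt)
             = of_int (m ^ 3 - m) / 12 * of_bool (m + n = 0)"
    by (auto simp: vir_cocycle_def witt_x_def lookup_single when_def)
  show ?thesis
    unfolding vir_x_def vir_bracket_def vir_scale_def fst_conv snd_conv 1 2
    by (simp add: witt_scale_zero)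
qed


section \<open>The Yang--Baxter equation in the Virasoro algebra\<close>

text \<open>
  In the Witt algebra \<open>[X, Y] = Y\<close>, so \<open>X \<otimes> Y - Y \<otimes> X\<close> solves the classical Yang--Baxter
  equation. In the Virasoro algebra the cocycle contributes a central term to \<open>[X, Y]\<close>, and the
  equation fails unless \<open>n\<close> is 0 or 2.
\<close>

lemma lookup_laurent_deriv:
  "Poly_Mapping.lookup (laurent_deriv p) j = of_int (j + 1) * Poly_Mapping.lookup p (j + 1)"
proof -
  have "Poly_Mapping.lookup (laurent_deriv p) j
      = (\<Sum>i\<in>Poly_Mapping.keys p. if i = j + 1 then of_int i * Poly_Mapping.lookup p i else 0)"
    unfolding laurent_deriv_def lookup_sum
    by (rule sum.cong) (auto simp: lookup_single when_def)
  also have "\<dots> = of_int (j + 1) * Poly_Mapping.lookup p (j + 1)"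
    by (auto simp: sum.delta in_keys_iff)
  finally show ?thesis .
qed

lemma laurent_deriv_add: "laurent_deriv (p + q) = laurent_deriv p + laurent_deriv q"
  by (rule poly_mapping_eqI) (simp add: lookup_laurent_deriv lookup_add algebra_simps)

lemma witt_bracket_add:
  "witt_bracket (a + b) c = witt_bracket a c + witt_bracket b c"
  "witt_bracket c (a + b) = witt_bracket c a + witt_bracket c b"
  by (simp_all add: witt_bracket_def laurent_deriv_add algebra_simps)

lemma vir_cocycle_superset:
  assumes "finite A" "Poly_Mapping.keys a \<subseteq> A"
  shows "vir_cocycle a b = (\<Sum>i\<in>A. Poly_Mapping.lookup a i * Poly_Mapping.lookup b (2 - i) *
        (of_int ((i - 1) ^ 3 - (i - 1)) / 12))"
  unfolding vir_cocycle_def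
  by (rule sum.mono_neutral_left) (use assms in \<open>auto simp: in_keys_iff\<close>)

lemma vir_cocycle_add:
  "vir_cocycle (a + b) c = vir_cocycle a c + vir_cocycle b c"
  "vir_cocycle c (a + b) = vir_cocycle c a + vir_cocycle c b"
proof -
  let ?A = "Poly_Mapping.keys a \<union> Poly_Mapping.keys b"
  have "finite ?A" "Poly_Mapping.keys (a + b) \<subseteq> ?A"
    using Poly_Mapping.keys_add[of a b] by auto
  then show "vir_cocycle (a + b) c = vir_cocycle a c + vir_cocycle b c"
    by (simp add: vir_cocycle_superset[of ?A] lookup_add sum.distrib [symmetric] distrib_right
        add_divide_distrib)
  show "vir_cocycle c (a + b) = vir_cocycle c a + vir_cocycle c b"
    by (simp add: vir_cocycle_def lookup_add sum.distrib [symmetric] algebra_simps)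
qed

lemma vir_cocycle_single:
  "vir_cocycle (Poly_Mapping.single i p) (Poly_Mapping.single j q)
     = (if i + j = 2 then p * q * (of_int ((i - 1) ^ 3 - (i - 1)) / 12) else 0)"
  by (cases "p = 0") (auto simp: vir_cocycle_def lookup_single when_def)

lemma witt_scale_mult: "witt_scale t p = Poly_Mapping.single 0 t * p"
proof (rule poly_mapping_eqI)
  fix i
  have "Poly_Mapping.lookup (Poly_Mapping.single 0 t * p) i = t * Poly_Mapping.lookup p i"
    by (simp add: times_poly_mapping.rep_eq prod_fun_def lookup_single when_mult)
  then show "Poly_Mapping.lookup (witt_scale t p) i = Poly_Mapping.lookup (Poly_Mapping.single 0 t * p) i"
    by (simp add: lookup_witt_scale)
qed

lemma laurent_deriv_scale: "laurent_deriv (witt_scale t p) = witt_scale t (laurent_deriv p)"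
  by (rule poly_mapping_eqI) (simp add: lookup_laurent_deriv lookup_witt_scale)

lemma witt_bracket_scale:
  "witt_bracket (witt_scale t a) b = witt_scale t (witt_bracket a b)"
  "witt_bracket a (witt_scale t b) = witt_scale t (witt_bracket a b)"
  unfolding witt_bracket_def laurent_deriv_scale
  by (simp_all add: witt_scale_mult algebra_simps)

lemma vir_cocycle_scale:
  "vir_cocycle (witt_scale t a) b = t * vir_cocycle a b"
  "vir_cocycle a (witt_scale t b) = t * vir_cocycle a b"
proof -
  have "Poly_Mapping.keys (witt_scale t a) \<subseteq> Poly_Mapping.keys a"
    by (auto simp: in_keys_iff lookup_witt_scale)
  then show "vir_cocycle (witt_scale t a) b = t * vir_cocycle a b"
    by (simp add: vir_cocycle_superset[of "Poly_Mapping.keys a"] lookup_witt_scale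
        sum_distrib_left mult.assoc)
  show "vir_cocycle a (witt_scale t b) = t * vir_cocycle a b"
    by (simp add: vir_cocycle_def lookup_witt_scale sum_distrib_left algebra_simps)
qed

lemma vir_bracket_linear:
  "vir_bracket (a + b) c = vir_bracket a c + vir_bracket b c"
  "vir_bracket c (a + b) = vir_bracket c a + vir_bracket c b"
  "vir_bracket (vir_scale t a) b = vir_scale t (vir_bracket a b)"
  "vir_bracket a (vir_scale t b) = vir_scale t (vir_bracket a b)"
  by (simp_all add: vir_bracket_def vir_scale_def witt_bracket_add witt_bracket_scale
      vir_cocycle_add vir_cocycle_scale plus_prod_def)

lemma vir_cocycle_skew: "vir_cocycle a b = - vir_cocycle b a"
proof -
  define A where "A = Poly_Mapping.keys a \<union> (\<lambda>i. 2 - i) ` Poly_Mapping.keys b"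
  have A: "finite A" "Poly_Mapping.keys a \<subseteq> A" by (auto simp: A_def)
  have A': "finite ((\<lambda>i. 2 - i) ` A)" "Poly_Mapping.keys b \<subseteq> (\<lambda>i. 2 - i) ` A"
    by (force simp: A_def image_iff)+
  have "vir_cocycle b a = (\<Sum>i\<in>A. Poly_Mapping.lookup b (2 - i) * Poly_Mapping.lookup a i *
        (of_int ((1 - i) ^ 3 - (1 - i)) / 12))"
    by (simp add: vir_cocycle_superset[OF A'] sum.reindex inj_on_def o_def)
  also have "\<dots> = - vir_cocycle a b"
    unfolding vir_cocycle_superset[OF A] sum_negf [symmetric]
    by (rule sum.cong) (simp_all add: power3_eq_cube diff_divide_distrib algebra_simps)
  finally show ?thesis by simp
qed

lemma vir_bracket_skew: "vir_bracket v w = - vir_bracket w v"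
  using vir_cocycle_skew[of "fst v" "fst w"]
  by (simp add: vir_bracket_def witt_bracket_def algebra_simps)

lemma vir_bracket_self: "vir_bracket v v = (0 :: 'f::field_char_0 virasoro)"
  using vir_cocycle_skew[of "fst v" "fst v"]
  by (simp add: vir_bracket_def witt_bracket_def zero_prod_def algebra_simps)

lemma vir_bracket_X_Y:
  fixes l k :: "'f::field_char_0"
  assumes n: "n \<noteq> 1" and l: "l \<noteq> 0"
  shows "vir_bracket (elem_X vir_scale vir_x n l) (elem_Y vir_scale vir_x n l k) =
           elem_Y vir_scale vir_x n l k + (0, - k * of_int (n * (n - 2)) / 24)"
proof -
  have n': "of_int n - 1 \<noteq> (0 :: 'f)"
    using n by (metis eq_iff_diff_eq_0 of_int_1 of_int_eq_iff)
  let ?s = "Poly_Mapping.single :: int \<Rightarrow> 'f \<Rightarrow> 'f witt"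
  let ?N = "of_int n - 1 :: 'f"
  define X where "X = ?s 1 (- (1 / ?N)) + ?s n l"
  define Y where "Y = ?s (2 - n) (- (k / (2 * ?N * l))) + ?s 1 k + ?s n (- (?N * l * k / 2))"
  have eX: "elem_X vir_scale vir_x n l = (X, 0)"
    by (simp add: elem_X_def vir_scale_def vir_x_def witt_x_def witt_scale_single X_def)
  have eY: "elem_Y vir_scale vir_x n l k = (Y, 0)"
    by (simp add: elem_Y_def vir_scale_def vir_x_def witt_x_def witt_scale_single Y_def)
  have ne: "1 \<noteq> 2 - n" "n \<noteq> 2 - n" "n \<noteq> 1" "2 - n \<noteq> n" using n by auto
  have W: "witt_bracket X Y = Y"
  proof (rule poly_mapping_eqI)
    fix j
    define N where "N = ?N"
    have N: "of_int n = N + 1" "N \<noteq> 0" using n' by (auto simp: N_def)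
    show "Poly_Mapping.lookup (witt_bracket X Y) j = Poly_Mapping.lookup Y j"
      using ne l N(2)
      by (simp add: X_def Y_def witt_bracket_add witt_bracket_single lookup_add
          lookup_single when_def N(1) split del: if_split)
        (auto simp: field_simps)
  qed
  have "vir_cocycle X Y = l * (- (k / (2 * ?N * l))) * (?N ^ 3 - ?N) / 12"
    using ne n by (auto simp: X_def Y_def vir_cocycle_add vir_cocycle_single)
  also have "\<dots> = - k * of_int (n * (n - 2)) / 24"
    using n' l by (simp add: field_simps power2_eq_square power3_eq_cube)
  finally show ?thesis
    by (simp add: eX eY vir_bracket_def W)
qed

lemma not_cybe_virasoro:
  fixes l k :: "'f::field_char_0"
  assumes n: "n \<notin> {0, 1, 2}" and l: "l \<noteq> 0" and k: "k \<noteq> 0"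
  shows "\<not> cybe vir_scale UNIV vir_bracket (r_matrix vir_scale vir_x n l k)"
proof
  define X Y where "X = elem_X vir_scale vir_x n l" and "Y = elem_Y vir_scale vir_x n l k"
  define p q z :: "'f virasoro \<Rightarrow> 'f" where "p = vir_eps 1" and "q = vir_eps n" and "z = snd"
  define M where "M = (\<lambda>a b d. p a * q b * z d)"
  define \<gamma> where "\<gamma> = - k * of_int (n * (n - 2)) / 24"
  define C :: "'f virasoro" where "C = (0, \<gamma>)"
  note defs = vir_eps_def witt_eps_def lookup_add vir_scale_def lookup_witt_scale
  have lin: "p (a + b) = p a + p b" "q (a + b) = q a + q b" "z (a + b) = z a + z b"
    "p (vir_scale t a) = t * p a" "q (vir_scale t a) = t * q a" "z (vir_scale t a) = t * z a"
    for a b t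
    by (simp_all add: p_def q_def z_def defs)
  have n': "of_int n - 1 \<noteq> (0 :: 'f)"
    using n by (metis eq_iff_diff_eq_0 insertI1 insertI2 of_int_1 of_int_eq_iff)
  have vals: "p X = - (1 / (of_int n - 1))" "q X = l" "z X = 0"
    "p Y = k" "q Y = - ((of_int n - 1) * l * k / 2)" "z Y = 0"
    using n by (auto simp: X_def Y_def elem_X_def elem_Y_def lin)
      (auto simp: p_def q_def z_def vir_x_def witt_x_def vir_eps_def witt_eps_def lookup_single)
  have brs: "vir_bracket X Y = Y + C" "vir_bracket X X = 0" "vir_bracket Y Y = 0"
    "vir_bracket Y X = - (Y + C)"
    using n l vir_bracket_skew[of Y X]
    by (simp_all add: X_def Y_def C_def \<gamma>_def vir_bracket_X_Y vir_bracket_self)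
  have c: "p C = 0" "q C = 0" "z C = \<gamma>"
    "p 0 = 0" "q 0 = 0" "z 0 = 0"
    by (simp_all add: p_def q_def z_def C_def defs)
  have neg: "p (- a) = - p a" "q (- a) = - q a" "z (- a) = - z a"
    "p (a - b) = p a - p b" "q (a - b) = q a - q b" "z (a - b) = z a - z b" for a b
    by (simp_all add: p_def q_def z_def defs lookup_minus)
  define F where "F = (\<lambda>a b c d.
    M (vir_bracket a c) b d + M a (vir_bracket b c) d + M a c (vir_bracket b d))"
  assume "cybe vir_scale UNIV vir_bracket (r_matrix vir_scale vir_x n l k)"
  moreover have "trilinear_form_on vir_scale UNIV M"
    by (simp add: trilinear_form_on_def bilinear_form_on_def bilinear_on_def M_def lin algebra_simps)
  ultimately have 0: "r_matrix vir_scale vir_x n l k (\<lambda>a b. r_matrix vir_scale vir_x n l k (F a b)) = 0"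
    unfolding cybe_def F_def by blast
  have r: "r_matrix vir_scale vir_x n l k B = B X Y - B Y X" if "bilinear_form_on vir_scale UNIV B" for B
    using that by (simp add: r_matrix_def pure_tensor_def X_def Y_def)
  have bil: "bilinear_form_on vir_scale UNIV (F a b)" for a b
    by (simp add: F_def bilinear_form_on_def bilinear_on_def M_def lin vir_bracket_linear algebra_simps)
  have bil': "bilinear_form_on vir_scale UNIV (\<lambda>a b. F a b X Y - F a b Y X)"
    by (simp add: F_def bilinear_form_on_def bilinear_on_def M_def lin vir_bracket_linear algebra_simps)
  have "(F X Y X Y - F X Y Y X) - (F Y X X Y - F Y X Y X) = 0"
    using 0 by (simp add: r bil bil')
  then have "\<gamma> * (k * l) = 0"
    using n' by (simp add: F_def M_def brs vals lin c neg field_simps)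
  moreover have "of_int n \<noteq> (0 :: 'f)" "of_int n - 2 \<noteq> (0 :: 'f)"
    using n by (auto simp: of_int_eq_iff [where 'a = 'f, of n 2, simplified])
  ultimately show False
    using k l by (simp add: \<gamma>_def)
qed

end

theory Submission
  imports Defs
begin

text \<open>
  If \<open>f [\<cdot>, \<cdot>]\<close> has finite rank, some \<open>u \<noteq> 0\<close> lies in its kernel together with \<open>x u\<close>, and
  \<open>[u, x v] - [x u, v] = 2 u v\<close> shows that \<open>f\<close> vanishes on the ideal generated by \<open>u\<close>, which is
  to say that its coefficients are linearly recursive. Conversely, functionals vanishing on a
  nonzero ideal form a good subspace, because \<open>f (u v)\<close> has finite rank in \<open>u\<close> and \<open>v\<close> and the
  square of an annihilating ideal is mapped into the ideal by differentiation. In the Virasoro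
  case finite rank also forces \<open>f c = 0\<close>.

  The dual bracket only involves \<open>f X\<close>, \<open>f Y\<close>, \<open>f [u, X]\<close> and \<open>f [u, Y]\<close>, and its Jacobi identity
  only uses that \<open>f [X, Y] = f Y\<close> for \<open>f\<close> in the dual. In the Virasoro algebra \<open>[X, Y] - Y\<close> is
  central, so this holds for every \<open>n\<close>, although the Yang--Baxter equation fails in general.
\<close>

section \<open>Functionals and tensors\<close>

text \<open>The dual comes without a basis, and tensors over it are functionals on bilinear forms,
  so every identity of tensors has to be brought back to values at vectors. Interpolation does this:
  a finite-dimensional space of functionals has evaluations at finitely many points as coordinates.
  Hence the map from \<open>V \<otimes> V\<close> to bilinear forms on the Lie algebra is injective,
  and the co-Jacobi identity and the compatibility condition in the dual become pointwise identities
  of the bracket. The same device separates the variables in \<open>f (u v)\<close> and produces the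
  common kernel vector \<open>u\<close>.

  Multiplication by \<open>x\<close> is singled out because \<open>x\<close> has derivative 1:
  comparing brackets before and after a shift by \<open>x\<close> recovers the product, and with it
  the ideals of Laurent polynomials, from the bracket alone. The finite rank argument is carried out
  only in the Virasoro algebra; good subspaces of the Witt algebra are pulled back to it along the
  projection.\<close>

interpretation fun_space: vector_space "fscale :: 'f::field \<Rightarrow> ('x \<Rightarrow> 'f) \<Rightarrow> 'x \<Rightarrow> 'f"
  by unfold_locales (auto simp: fscale_def algebra_simps)

interpretation form_space:
  vector_space "(\<lambda>c B u v. c * B u v) :: 'f::field \<Rightarrow> ('x \<Rightarrow> 'y \<Rightarrow> 'f) \<Rightarrow> 'x \<Rightarrow> 'y \<Rightarrow> 'f"
  by unfold_locales (auto simp: fun_eq_iff algebra_simps)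

lemma sum_apply: "(\<Sum>i\<in>A. f i) x = (\<Sum>i\<in>A. f i x)"
  by (induction A rule: infinite_finite_induct) auto

lemma fscale_apply: "fscale c f x = c * f x"
  by (simp add: fscale_def)

lemma fun_sum_eq_fscale: "(\<lambda>x. \<Sum>i\<in>A. c i * \<phi> i x) = (\<Sum>i\<in>A. fscale (c i) (\<phi> i))"
  by (simp add: fun_eq_iff fscale_def sum_apply)

lemma fun_sum_in_subspace:
  assumes "fun_space.subspace V" "\<And>i. i \<in> A \<Longrightarrow> \<phi> i \<in> V"
  shows "(\<lambda>x. \<Sum>i\<in>A. c i * \<phi> i x) \<in> V"
  unfolding fun_sum_eq_fscale
  by (intro fun_space.subspace_sum fun_space.subspace_scale assms)

text \<open>The \<open>\<phi> i\<close> form the basis of the span that is dual to evaluation at the points \<open>p i\<close>.\<close>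

lemma finite_interpolation:
  fixes G :: "('x \<Rightarrow> 'f::field) set"
  assumes "finite G"
  shows "\<exists>N (p :: nat \<Rightarrow> 'x) \<phi>. (\<forall>i<N. \<phi> i \<in> fun_space.span G) \<and>
    (\<forall>g\<in>fun_space.span G. \<forall>x. g x = (\<Sum>i<N. g (p i) * \<phi> i x))"
  using assms
proof (induction G)
  case empty
  then show ?case by (intro exI[of _ 0]) auto
next
  case (insert g G)
  let ?S = "fun_space.span G" and ?T = "fun_space.span (insert g G)"
  obtain N and p :: "nat \<Rightarrow> 'x" and \<phi> where
    \<phi>: "\<And>i. i < N \<Longrightarrow> \<phi> i \<in> ?S" and
    ex: "\<And>h x. h \<in> ?S \<Longrightarrow> h x = (\<Sum>i<N. h (p i) * \<phi> i x)"
    using insert.IH by blast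
  have ST: "h \<in> ?T" if "h \<in> ?S" for h
    using that fun_space.span_mono[of G "insert g G"] by auto
  \<comment> \<open>The error of interpolating \<open>g\<close> at the old points. If it is not 0, a
    point where it does not vanish becomes the new node.\<close>
  define g' where "g' = g - (\<lambda>x. \<Sum>i<N. g (p i) * \<phi> i x)"
  have red: "(\<lambda>x. \<Sum>i<N. g (p i) * \<phi> i x) \<in> ?S"
    by (intro fun_sum_in_subspace) (auto simp: \<phi>)
  show ?case
  proof (cases "g' = 0")
    case True
    then have "g \<in> ?S" using red by (simp add: g'_def)
    then have "?T = ?S" by (rule fun_space.span_redundant)
    with \<phi> ex show ?thesis by (intro exI[of _ N] exI[of _ p] exI[of _ \<phi>]) auto
  next
    case False
    then obtain x where x: "g' x \<noteq> 0" by (auto simp: fun_eq_iff)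
    define \<psi> where "\<psi> = fscale (1 / g' x) g'"
    \<comment> \<open>Since \<open>\<psi> x = 1\<close>, the correction makes the old functions
      vanish at the new node \<open>x\<close>.\<close>
    define \<phi>' where "\<phi>' = (\<lambda>i. if i = N then \<psi> else \<phi> i - fscale (\<phi> i x) \<psi>)"
    define p' where "p' = (\<lambda>i. if i = N then x else p i)"
    have g'T: "g' \<in> ?T"
      unfolding g'_def by (intro fun_space.span_diff ST red fun_space.span_base) simp
    have "\<phi>' i \<in> ?T" if "i < Suc N" for i
      using that ST[OF \<phi>] g'T unfolding \<phi>'_def \<psi>_def
      by (auto simp: less_Suc_eq intro!: fun_space.span_diff fun_space.span_scale)
    moreover have "h y = (\<Sum>i<Suc N. h (p' i) * \<phi>' i y)" if hT: "h \<in> ?T" for h y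
    proof -
      obtain c where c: "h - fscale c g \<in> ?S"
        using fun_space.span_breakdown_eq[of h g G] hT by blast
      have eq: "h - fscale c g' = (h - fscale c g) + fscale c (\<lambda>x. \<Sum>i<N. g (p i) * \<phi> i x)"
        by (simp add: g'_def fscale_def fun_eq_iff algebra_simps)
      have S: "h - fscale c g' \<in> ?S"
        unfolding eq by (rule fun_space.span_add[OF c fun_space.span_scale[OF red]])
      define h0 where "h0 = h - fscale c g'"
      have h0: "h0 z = (\<Sum>i<N. h0 (p i) * \<phi> i z)" for z
        using ex[OF S, of z] by (simp add: h0_def)
      \<comment> \<open>The induction hypothesis does not say
        \<open>\<phi> i (p j) = \<delta>\<^sub>i\<^sub>j\<close>. Instead of
        \<open>g' (p i) = 0\<close>, the interpolation formula is applied to the interpolant of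
        \<open>g\<close> itself, which it reproduces.\<close>
      have g'p: "(\<Sum>i<N. g' (p i) * \<phi> i z) = 0" for z
      proof -
        have "g (p i) - g' (p i) = (\<Sum>j<N. g (p j) * \<phi> j (p i))" for i
          by (simp add: g'_def)
        then have "(\<Sum>i<N. (g (p i) - g' (p i)) * \<phi> i z) = (\<Sum>j<N. g (p j) * \<phi> j z)"
          using ex[OF red, of z] by simp
        then show ?thesis
          by (simp add: algebra_simps sum_subtractf)
      qed
      have h: "h z = h0 z + c * g' z" for z
        by (simp add: h0_def fscale_def)
      have hp: "(\<Sum>i<N. h (p i) * \<phi> i z) = h0 z" for z
        using h0[of z] g'p[of z]
        by (simp add: h distrib_right sum.distrib mult.assoc sum_distrib_left[symmetric])
      have "(\<Sum>i<Suc N. h (p' i) * \<phi>' i y)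
          = (\<Sum>i<N. h (p i) * (\<phi> i y - \<phi> i x * \<psi> y)) + h x * \<psi> y"
        by (simp add: p'_def \<phi>'_def fscale_def)
      also have "\<dots> = h0 y - h0 x * \<psi> y + h x * \<psi> y"
        using hp[of x] hp[of y]
        by (simp add: right_diff_distrib sum_subtractf sum_distrib_right[symmetric]
            mult.assoc[symmetric])
      also have "\<dots> = h y"
        using x h[of x] h[of y] by (simp add: \<psi>_def fscale_def algebra_simps)
      finally show ?thesis by simp
    qed
    ultimately show ?thesis by blast
  qed
qed

section \<open>Expansion of multilinear forms by point evaluations\<close>

lemma bilinear_form_on_sum:
  assumes B: "bilinear_form_on s S B" and S: "vector_space s" "module.subspace s S"
    and x: "\<And>i. i \<in> A \<Longrightarrow> x i \<in> S" and b: "b \<in> S"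
  shows "B (\<Sum>i\<in>A. s (c i) (x i)) b = (\<Sum>i\<in>A. c i * B (x i) b)"
    "B b (\<Sum>i\<in>A. s (c i) (x i)) = (\<Sum>i\<in>A. c i * B b (x i))"
proof -
  interpret vector_space s by (rule S(1))
  have B0: "B 0 b = 0" "B b 0 = 0"
  proof -
    have "B (s 0 b) b = 0 * B b b" "B b (s 0 b) = 0 * B b b"
      using B b unfolding bilinear_form_on_def bilinear_on_def by blast+
    then show "B 0 b = 0" "B b 0 = 0" by simp_all
  qed
  \<comment> \<open>\<open>B\<close> is constrained only on \<open>S\<close>, so every partial sum
    must stay in \<open>S\<close> before additivity can be used.\<close>
  have mem: "sum (\<lambda>i. s (c i) (x i)) F \<in> S" if "F \<subseteq> A" for F
    using that by (intro subspace_sum subspace_scale S) (auto simp: x)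
  have "B (\<Sum>i\<in>A. s (c i) (x i)) b = (\<Sum>i\<in>A. c i * B (x i) b) \<and>
    B b (\<Sum>i\<in>A. s (c i) (x i)) = (\<Sum>i\<in>A. c i * B b (x i))"
  proof (cases "finite A")
    case True
    then show ?thesis using x mem
    proof (induction A)
      case (insert i A)
      have "s (c i) (x i) \<in> S" "x i \<in> S" "(\<Sum>i\<in>A. s (c i) (x i)) \<in> S"
        using insert.prems by (auto intro!: subspace_scale S)
      moreover have "B (\<Sum>i\<in>A. s (c i) (x i)) b = (\<Sum>i\<in>A. c i * B (x i) b) \<and>
        B b (\<Sum>i\<in>A. s (c i) (x i)) = (\<Sum>i\<in>A. c i * B b (x i))"
        using insert.prems by (intro insert.IH) auto
      ultimately show ?case
        using B b insert.hyps unfolding bilinear_form_on_def bilinear_on_def by simp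
    qed (simp add: B0)
  qed (simp add: B0)
  then show "B (\<Sum>i\<in>A. s (c i) (x i)) b = (\<Sum>i\<in>A. c i * B (x i) b)"
    "B b (\<Sum>i\<in>A. s (c i) (x i)) = (\<Sum>i\<in>A. c i * B b (x i))" by auto
qed

lemma trilinear_form_onD:
  assumes "trilinear_form_on s S M" "x \<in> S"
  shows "bilinear_form_on s S (\<lambda>a b. M a b x)" "bilinear_form_on s S (\<lambda>b c. M x b c)"
  using assms by (auto simp: trilinear_form_on_def)

text \<open>Interpolation in the span of \<open>G\<close> replaces a choice of basis. The
  coefficients are values of functionals at points, so a sum of terms \<open>B x y\<close> is
  controlled by the numbers obtained by evaluating the corresponding sum of products.\<close>

lemma multilinear_form_expand:
  fixes V :: "('x \<Rightarrow> 'f::field) set"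
  assumes V: "fun_space.subspace V" and G: "finite G" "G \<subseteq> V"
  shows "\<exists>(N::nat) p \<phi>.
    (\<forall>B. bilinear_form_on fscale V B \<longrightarrow> (\<forall>x\<in>G. \<forall>y\<in>G.
       B x y = (\<Sum>i<N. \<Sum>j<N. x (p i) * y (p j) * B (\<phi> i) (\<phi> j)))) \<and>
    (\<forall>M. trilinear_form_on fscale V M \<longrightarrow> (\<forall>x\<in>G. \<forall>y\<in>G. \<forall>z\<in>G.
       M x y z = (\<Sum>i<N. \<Sum>j<N. \<Sum>k<N. x (p i) * y (p j) * z (p k) * M (\<phi> i) (\<phi> j) (\<phi> k))))"
proof -
  obtain N and p :: "nat \<Rightarrow> 'x" and \<phi> where
    \<phi>: "\<And>i. i < N \<Longrightarrow> \<phi> i \<in> fun_space.span G" and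
    ex: "\<And>h x. h \<in> fun_space.span G \<Longrightarrow> h x = (\<Sum>i<N. h (p i) * \<phi> i x)"
    using finite_interpolation[OF G(1)] by blast
  have \<phi>V: "\<phi> i \<in> V" if "i < N" for i
    using \<phi>[OF that] fun_space.span_minimal[OF G(2) V] by blast
  have exG: "x = (\<Sum>i<N. fscale (x (p i)) (\<phi> i))" if "x \<in> G" for x
    by (rule ext, simp add: fscale_def sum_apply) (rule ex[OF fun_space.span_base[OF that]])
  note sums = bilinear_form_on_sum[OF _ fun_space.vector_space_axioms V]
  have bil: "B x y = (\<Sum>i<N. \<Sum>j<N. x (p i) * y (p j) * B (\<phi> i) (\<phi> j))"
    if B: "bilinear_form_on fscale V B" and x: "x \<in> G" and y: "y \<in> G" for B x y
  proof -
    have "B x y = B (\<Sum>i<N. fscale (x (p i)) (\<phi> i)) y"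
      by (rule arg_cong[OF exG[OF x], of "\<lambda>x. B x y"])
    also have "\<dots> = (\<Sum>i<N. x (p i) * B (\<phi> i) y)"
      by (rule sums(1)[OF B]) (use \<phi>V y G in auto)
    also have "\<dots> = (\<Sum>i<N. x (p i) * (\<Sum>j<N. y (p j) * B (\<phi> i) (\<phi> j)))"
    proof (rule sum.cong)
      fix i assume "i \<in> {..<N}"
      then have i: "\<phi> i \<in> V" by (simp add: \<phi>V)
      have "B (\<phi> i) y = B (\<phi> i) (\<Sum>j<N. fscale (y (p j)) (\<phi> j))"
        by (rule arg_cong[OF exG[OF y]])
      also have "\<dots> = (\<Sum>j<N. y (p j) * B (\<phi> i) (\<phi> j))"
        by (rule sums(2)[OF B]) (use \<phi>V i in auto)
      finally show "x (p i) * B (\<phi> i) y = x (p i) * (\<Sum>j<N. y (p j) * B (\<phi> i) (\<phi> j))" by simp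
    qed simp
    finally show ?thesis by (simp add: sum_distrib_left mult.assoc)
  qed
  have "M x y z = (\<Sum>i<N. \<Sum>j<N. \<Sum>k<N. x (p i) * y (p j) * z (p k) * M (\<phi> i) (\<phi> j) (\<phi> k))"
    if M: "trilinear_form_on fscale V M" and x: "x \<in> G" and y: "y \<in> G" and z: "z \<in> G" for M x y z
  proof -
    have "z \<in> V" "y \<in> V" using y z G by auto
    have "M x y z = M (\<Sum>i<N. fscale (x (p i)) (\<phi> i)) y z"
      by (rule arg_cong[OF exG[OF x], of "\<lambda>x. M x y z"])
    also have "\<dots> = (\<Sum>i<N. x (p i) * M (\<phi> i) y z)"
      by (rule sums(1)[OF trilinear_form_onD(1)[OF M \<open>z \<in> V\<close>]]) (use \<phi>V \<open>y \<in> V\<close> in auto)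
    also have "\<dots> = (\<Sum>i<N. x (p i) * (\<Sum>j<N. \<Sum>k<N. y (p j) * z (p k) * M (\<phi> i) (\<phi> j) (\<phi> k)))"
      using \<phi>V bil[OF trilinear_form_onD(2)[OF M] y z] by (intro sum.cong) auto
    finally show ?thesis by (simp add: sum_distrib_left mult.assoc)
  qed
  with bil show ?thesis
    by (intro exI[of _ N] exI[of _ p] exI[of _ \<phi>]) blast
qed

section \<open>Tensors as finite sums, and their faithful realisation as forms\<close>

lemma tensor_square_rep:
  assumes "vector_space s" "module.subspace s S" "T \<in> tensor_square s S"
  shows "\<exists>(N::nat) a b. (\<forall>i<N. a i \<in> S \<and> b i \<in> S) \<and>
    T = (\<lambda>B. if bilinear_form_on s S B then \<Sum>i<N. B (a i) (b i) else 0)"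
proof -
  interpret vector_space s by fact
  show ?thesis
    using assms(3) unfolding tensor_square_def
  proof (induction rule: fun_space.span_induct_alt)
    case base
    show ?case by (intro exI[of _ 0]) (auto simp: fun_eq_iff)
  next
    case (step c x y)
    obtain N :: nat and a b where ab: "\<forall>i<N. a i \<in> S \<and> b i \<in> S"
      "y = (\<lambda>B. if bilinear_form_on s S B then \<Sum>i<N. B (a i) (b i) else 0)"
      using step.IH by blast
    obtain a' b' where x: "x = pure_tensor s S a' b'" "a' \<in> S" "b' \<in> S"
      using step.hyps by blast
    \<comment> \<open>The scalar of a span element is absorbed into the left factor, so that plain
      sums of products suffice.\<close>
    have "s c a' \<in> S" using x assms(2) by (simp add: subspace_scale)
    then show ?case using ab x
      by (intro exI[of _ "Suc N"] exI[of _ "a(N := s c a')"] exI[of _ "b(N := b')"])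
        (auto simp: fun_eq_iff fscale_def pure_tensor_def less_Suc_eq
          bilinear_form_on_def bilinear_on_def)
  qed
qed

lemma tensor_square_sum:
  assumes "\<And>i. i < N \<Longrightarrow> a i \<in> S \<and> b i \<in> S"
  shows "(\<lambda>B. if bilinear_form_on s S B then \<Sum>i<(N::nat). B (a i) (b i) else 0) \<in> tensor_square s S"
proof -
  have "(\<lambda>B. if bilinear_form_on s S B then \<Sum>i<N. B (a i) (b i) else 0)
      = (\<Sum>i<N. pure_tensor s S (a i) (b i))"
    by (auto simp: fun_eq_iff sum_apply pure_tensor_def)
  also have "\<dots> \<in> tensor_square s S"
    unfolding tensor_square_def by (intro fun_space.span_sum fun_space.span_base) (use assms in auto)
  finally show ?thesis .
qed

lemma form_square_rep:
  fixes V :: "('x \<Rightarrow> 'f::field) set"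
  assumes "fun_space.subspace V" "\<Phi> \<in> form_square V"
  shows "\<exists>(N::nat) a b. (\<forall>i<N. a i \<in> V \<and> b i \<in> V) \<and> \<Phi> = (\<lambda>u v. \<Sum>i<N. a i u * b i v)"
  using assms(2) unfolding form_square_def
proof (induction rule: form_space.span_induct_alt)
  case base
  show ?case by (intro exI[of _ 0]) (auto simp: fun_eq_iff)
next
  case (step c x y)
  obtain N :: nat and a b where ab: "\<forall>i<N. a i \<in> V \<and> b i \<in> V"
    "y = (\<lambda>u v. \<Sum>i<N. a i u * b i v)"
    using step.IH by blast
  obtain a' b' where x: "x = (\<lambda>u v. a' u * b' v)" "a' \<in> V" "b' \<in> V"
    using step.hyps by blast
  have "fscale c a' \<in> V" using x assms(1) by (simp add: fun_space.subspace_scale)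
  then show ?case using ab x
    by (intro exI[of _ "Suc N"] exI[of _ "a(N := fscale c a')"] exI[of _ "b(N := b')"])
      (auto simp: fun_eq_iff fscale_def less_Suc_eq)
qed

lemma form_square_sum:
  assumes "\<And>i. i < N \<Longrightarrow> a i \<in> V \<and> b i \<in> V"
  shows "(\<lambda>u v. \<Sum>i<(N::nat). a i u * b i v) \<in> form_square V"
proof -
  have "(\<lambda>u v. \<Sum>i<N. a i u * b i v) = (\<Sum>i<N. (\<lambda>u v. a i u * b i v))"
    by (auto simp: fun_eq_iff sum_apply)
  also have "\<dots> \<in> form_square V"
    unfolding form_square_def by (intro form_space.span_sum form_space.span_base) (use assms in auto)
  finally show ?thesis .
qed

lemma bilinear_form_on_eval: "bilinear_form_on fscale V (\<lambda>f g. f u * g v)"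
  by (simp add: bilinear_form_on_def bilinear_on_def fscale_def algebra_simps)

text \<open>Injectivity of \<open>V \<otimes> V\<close> into bilinear forms. By
  \<open>multilinear_form_expand\<close>, applied to all factors of both tensors, \<open>T B\<close>
  depends only on the values of \<open>tensor_to_form T\<close> at pairs of nodes.\<close>

lemma tensor_eqI:
  fixes V :: "('x \<Rightarrow> 'f::field) set"
  assumes V: "fun_space.subspace V"
    and T: "T \<in> tensor_square fscale V" "T' \<in> tensor_square fscale V"
    and eq: "tensor_to_form T = tensor_to_form T'"
  shows "T = T'"
proof -
  obtain N :: nat and a b where ab: "\<forall>i<N. a i \<in> V \<and> b i \<in> V"
    "T = (\<lambda>B. if bilinear_form_on fscale V B then \<Sum>i<N. B (a i) (b i) else 0)"
    using tensor_square_rep[OF fun_space.vector_space_axioms V T(1)] by blast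
  obtain N' :: nat and a' b' where ab': "\<forall>i<N'. a' i \<in> V \<and> b' i \<in> V"
    "T' = (\<lambda>B. if bilinear_form_on fscale V B then \<Sum>i<N'. B (a' i) (b' i) else 0)"
    using tensor_square_rep[OF fun_space.vector_space_axioms V T(2)] by blast
  define G where "G = a ` {..<N} \<union> b ` {..<N} \<union> a' ` {..<N'} \<union> b' ` {..<N'}"
  have G: "finite G" "G \<subseteq> V" using ab ab' by (auto simp: G_def)
  obtain K :: nat and p \<phi> where ex:
    "\<forall>B. bilinear_form_on fscale V B \<longrightarrow> (\<forall>x\<in>G. \<forall>y\<in>G.
       B x y = (\<Sum>i<K. \<Sum>j<K. x (p i) * y (p j) * B (\<phi> i) (\<phi> j)))"
    "\<forall>M. trilinear_form_on fscale V M \<longrightarrow> (\<forall>x\<in>G. \<forall>y\<in>G. \<forall>z\<in>G.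
       M x y z = (\<Sum>i<K. \<Sum>j<K. \<Sum>k<K. x (p i) * y (p j) * z (p k) * M (\<phi> i) (\<phi> j) (\<phi> k)))"
    using multilinear_form_expand[OF V G] by blast
  \<comment> \<open>Moving the sum over the terms of the tensor innermost turns it into a value of
    the associated form.\<close>
  have sw: "(\<Sum>t<L. \<Sum>i<K. \<Sum>j<K. x t (p i) * y t (p j) * B (\<phi> i) (\<phi> j))
    = (\<Sum>i<K. \<Sum>j<K. (\<Sum>t<L. x t (p i) * y t (p j)) * B (\<phi> i) (\<phi> j))"
    for x y :: "nat \<Rightarrow> 'x \<Rightarrow> 'f" and L :: nat and B
    by (subst sum.swap, rule sum.cong[OF refl], subst sum.swap, rule sum.cong[OF refl])
      (simp add: sum_distrib_right)
  have form: "(\<Sum>t<N. a t u * b t v) = (\<Sum>t<N'. a' t u * b' t v)" for u v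
    using fun_cong[OF fun_cong[OF eq, of u], of v]
    by (simp add: tensor_to_form_def ab(2) ab'(2) bilinear_form_on_eval)
  show ?thesis
  proof
    fix B
    show "T B = T' B"
    proof (cases "bilinear_form_on fscale V B")
      case True
      have "T B = (\<Sum>t<N. \<Sum>i<K. \<Sum>j<K. a t (p i) * b t (p j) * B (\<phi> i) (\<phi> j))"
        by (simp add: ab(2) True) (intro sum.cong refl ex(1)[rule_format, OF True]; simp add: G_def)
      moreover have "T' B = (\<Sum>t<N'. \<Sum>i<K. \<Sum>j<K. a' t (p i) * b' t (p j) * B (\<phi> i) (\<phi> j))"
        by (simp add: ab'(2) True) (intro sum.cong refl ex(1)[rule_format, OF True]; simp add: G_def)
      ultimately show ?thesis by (simp only: sw form)
    qed (simp add: ab(2) ab'(2))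
  qed
qed

text \<open>The analogue of \<open>tensor_eqI\<close> for three factors, in the shape of the
  co-Jacobi identity: a cyclic sum that vanishes at all triples of vectors vanishes under every
  trilinear form.\<close>

lemma trilinear_cyclic_sum_eq_0:
  fixes V :: "('x \<Rightarrow> 'f::field) set"
  assumes V: "fun_space.subspace V" and M: "trilinear_form_on fscale V M" and K: "finite K"
    and mem: "\<And>t. t \<in> K \<Longrightarrow> x t \<in> V \<and> y t \<in> V \<and> z t \<in> V"
    and 0: "\<And>u v w. (\<Sum>t\<in>K. x t u * y t v * z t w + y t u * z t v * x t w + z t u * x t v * y t w) = 0"
  shows "(\<Sum>t\<in>K. M (x t) (y t) (z t) + M (y t) (z t) (x t) + M (z t) (x t) (y t)) = 0"
proof -
  define G where "G = x ` K \<union> y ` K \<union> z ` K"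
  have G: "finite G" "G \<subseteq> V" using K mem by (auto simp: G_def)
  obtain N :: nat and p \<phi> where ex:
    "\<forall>B. bilinear_form_on fscale V B \<longrightarrow> (\<forall>x\<in>G. \<forall>y\<in>G.
       B x y = (\<Sum>i<N. \<Sum>j<N. x (p i) * y (p j) * B (\<phi> i) (\<phi> j)))"
    "\<forall>M. trilinear_form_on fscale V M \<longrightarrow> (\<forall>x\<in>G. \<forall>y\<in>G. \<forall>z\<in>G.
       M x y z = (\<Sum>i<N. \<Sum>j<N. \<Sum>k<N. x (p i) * y (p j) * z (p k) * M (\<phi> i) (\<phi> j) (\<phi> k)))"
    using multilinear_form_expand[OF V G] by blast
  have "(\<Sum>t\<in>K. M (x t) (y t) (z t) + M (y t) (z t) (x t) + M (z t) (x t) (y t))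
    = (\<Sum>t\<in>K. \<Sum>i<N. \<Sum>j<N. \<Sum>k<N.
        (x t (p i) * y t (p j) * z t (p k) + y t (p i) * z t (p j) * x t (p k) +
         z t (p i) * x t (p j) * y t (p k)) * M (\<phi> i) (\<phi> j) (\<phi> k))"
    by (intro sum.cong refl) (simp add: ex(2)[rule_format, OF M] G_def distrib_right sum.distrib)
  also have "\<dots> = (\<Sum>i<N. \<Sum>j<N. \<Sum>k<N. (\<Sum>t\<in>K.
        x t (p i) * y t (p j) * z t (p k) + y t (p i) * z t (p j) * x t (p k) +
         z t (p i) * x t (p j) * y t (p k)) * M (\<phi> i) (\<phi> j) (\<phi> k))"
    by (subst sum.swap, rule sum.cong[OF refl], subst sum.swap, rule sum.cong[OF refl],
        subst sum.swap, rule sum.cong[OF refl])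
      (simp add: sum_distrib_right)
  finally show ?thesis by (simp only: 0) simp
qed

section \<open>The dual Lie coalgebra\<close>

lemma full_dual_iff:
  "vector_space s \<Longrightarrow> f \<in> full_dual s \<longleftrightarrow> (\<forall>a b. f (a + b) = f a + f b) \<and> (\<forall>t a. f (s t a) = t * f a)"
  by (auto simp: full_dual_def Vector_Spaces.linear_iff vector_space_def algebra_simps)

lemma subspace_full_dual: "vector_space s \<Longrightarrow> fun_space.subspace (full_dual s)"
  by (auto simp: fun_space.subspace_def full_dual_iff fscale_def algebra_simps)

lemma form_square_mono: "V \<subseteq> W \<Longrightarrow> form_square V \<subseteq> form_square W"
  unfolding form_square_def by (rule form_space.span_mono) blast

text \<open>The transpose of the bracket is linear in the functional, and \<open>form_square\<close>
  is monotone, so a combination of elements of different good subspaces stays within the form square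
  of their sum.\<close>

lemma good_subspace_lie_dual:
  assumes "vector_space s"
  shows "good_subspace s br (lie_dual s br)"
proof -
  let ?U = "\<Union> {V. good_subspace s br V}"
  have "lie_dual s br \<subseteq> full_dual s"
    unfolding lie_dual_def
    by (rule fun_space.span_minimal[OF _ subspace_full_dual[OF assms]])
      (auto simp: good_subspace_def)
  moreover have "bracket_transpose br f \<in> form_square (lie_dual s br)" if "f \<in> lie_dual s br" for f
    using that unfolding lie_dual_def
  proof (induction rule: fun_space.span_induct_alt)
    case base
    show ?case
      using form_space.span_zero[unfolded zero_fun_def]
      by (simp add: bracket_transpose_def form_square_def zero_fun_def)
  next
    case (step c x y)
    then obtain V where V: "good_subspace s br V" "x \<in> V" by blast
    then have "V \<subseteq> fun_space.span ?U" by (auto intro: fun_space.span_base)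
    then have x: "bracket_transpose br x \<in> form_square (fun_space.span ?U)"
      using V form_square_mono unfolding good_subspace_def by blast
    have "bracket_transpose br (fscale c x + y)
        = (\<lambda>u v. c * bracket_transpose br x u v) + bracket_transpose br y"
      by (simp add: bracket_transpose_def fscale_def fun_eq_iff)
    also have "\<dots> \<in> form_square (fun_space.span ?U)"
      using x step.IH unfolding form_square_def
      by (intro form_space.span_add form_space.span_scale)
    finally show ?case .
  qed
  ultimately show ?thesis
    by (simp add: good_subspace_def) (simp add: lie_dual_def fun_space.subspace_span)
qed

lemma lie_dual_eqI:
  assumes "good_subspace s br D" "\<And>V. good_subspace s br V \<Longrightarrow> V \<subseteq> D"
  shows "lie_dual s br = D"
proof
  show "lie_dual s br \<subseteq> D"
    unfolding lie_dual_def
  proof (rule fun_space.span_minimal)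
    show "\<Union> {V. good_subspace s br V} \<subseteq> D" using assms(2) by blast
    show "fun_space.subspace D" using assms(1) by (simp add: good_subspace_def)
  qed
  show "D \<subseteq> lie_dual s br"
    unfolding lie_dual_def using assms(1) by (auto intro: fun_space.span_base)
qed

lemma tensor_to_form_rep:
  "tensor_to_form (\<lambda>B. if bilinear_form_on fscale V B then \<Sum>i<(N::nat). B (a i) (b i) else 0)
    = (\<lambda>u v. \<Sum>i<N. a i u * b i v)"
  by (simp add: tensor_to_form_def bilinear_form_on_eval)

text \<open>\<open>tensor_eqI\<close> gives the uniqueness behind the \<open>THE\<close>. A
  cobracket is thus identified by checking values on pairs of vectors.\<close>

lemma dual_cobracket_eqI:
  assumes "fun_space.subspace (lie_dual s br)" "T \<in> tensor_square fscale (lie_dual s br)"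
    "tensor_to_form T = bracket_transpose br f"
  shows "dual_cobracket s br f = T"
  unfolding dual_cobracket_def
  by (rule the_equality) (use assms in \<open>auto intro: tensor_eqI\<close>)

lemma tensor_square_closed:
  "T \<in> tensor_square s' S \<Longrightarrow> T' \<in> tensor_square s' S \<Longrightarrow> T + T' \<in> tensor_square s' S"
  "T \<in> tensor_square s' S \<Longrightarrow> T' \<in> tensor_square s' S \<Longrightarrow> T - T' \<in> tensor_square s' S"
  "T \<in> tensor_square s' S \<Longrightarrow> fscale c T \<in> tensor_square s' S"
  "T \<in> tensor_square s' S \<Longrightarrow> - T \<in> tensor_square s' S"
  "a \<in> S \<Longrightarrow> b \<in> S \<Longrightarrow> pure_tensor s' S a b \<in> tensor_square s' S"
  "(\<And>i. i \<in> A \<Longrightarrow> F i \<in> tensor_square s' S) \<Longrightarrow> sum F A \<in> tensor_square s' S"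
  unfolding tensor_square_def
  by (auto intro: fun_space.span_add fun_space.span_scale fun_space.span_diff fun_space.span_neg
      fun_space.span_base fun_space.span_sum)

lemma bilinear_form_on_flip:
  "bilinear_form_on s' S (\<lambda>a b. B b a) \<longleftrightarrow> bilinear_form_on s' S B"
  by (auto simp: bilinear_form_on_def bilinear_on_def)

section \<open>The Lie coalgebra structure of the dual of an arbitrary Lie algebra\<close>

locale lie_alg =
  fixes s :: "'f::field \<Rightarrow> 'v::ab_group_add \<Rightarrow> 'v" and br :: "'v \<Rightarrow> 'v \<Rightarrow> 'v"
  assumes lie: "lie_algebra s UNIV br"
begin

lemma vs: "vector_space s"
  using lie by (simp add: lie_algebra_def)

lemma br_linear:
  "br (a + b) c = br a c + br b c" "br c (a + b) = br c a + br c b"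
  "br (s t a) b = s t (br a b)" "br a (s t b) = s t (br a b)"
  using lie by (auto simp: lie_algebra_def bilinear_on_def)

lemma br_self: "br a a = 0"
  using lie by (auto simp: lie_algebra_def)

lemma br_skew: "br a b = - br b a"
proof -
  have "br b a + br a b = 0"
    using br_self[of "a + b", unfolded br_linear(1,2)] by (simp add: br_self)
  then show ?thesis by (simp add: eq_neg_iff_add_eq_0 add.commute)
qed

lemma jacobi: "br a (br b c) + br b (br c a) + br c (br a b) = 0"
  using lie by (auto simp: lie_algebra_def)

lemma br_zero: "br 0 a = 0" "br a 0 = 0"
  using br_linear(1)[of 0 0 a] br_linear(2)[of a 0 0] by simp_all

lemma br_minus: "br (- a) b = - br a b" "br a (- b) = - br a b"
  using br_linear(1)[of a "- a" b] br_linear(2)[of a b "- b"]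
  by (simp_all add: br_zero eq_neg_iff_add_eq_0 add.commute)

lemma br_br: "br (br u v) w = br u (br v w) - br v (br u w)"
  using jacobi[of u v w] br_skew[of "br u v" w] br_skew[of w u]
  by (simp add: br_minus algebra_simps)

abbreviation "V \<equiv> lie_dual s br"
abbreviation "cobr \<equiv> dual_cobracket s br"

lemma good_V: "good_subspace s br V"
  by (rule good_subspace_lie_dual[OF vs])

lemma V_subspace: "fun_space.subspace V"
  using good_V by (simp add: good_subspace_def)

lemma V_linear:
  assumes "f \<in> V"
  shows "f (a + b) = f a + f b" "f (s t a) = t * f a" "f (- a) = - f a" "f 0 = 0"
proof -
  have f: "f \<in> full_dual s" using assms good_V by (auto simp: good_subspace_def)
  then show add: "f (a + b) = f a + f b" and "f (s t a) = t * f a" for a b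
    using full_dual_iff[OF vs] by blast+
  have "f 0 + f 0 = f 0 + 0" using add[of 0 0] by simp
  then show "f 0 = 0" by (simp only: add_left_cancel)
  then show "f (- a) = - f a" using add[of a "- a"] by (simp add: eq_neg_iff_add_eq_0 add.commute)
qed

lemma cobr_rep:
  assumes "f \<in> V"
  shows "\<exists>(N::nat) a b. (\<forall>i<N. a i \<in> V \<and> b i \<in> V) \<and>
    (\<forall>u v. f (br u v) = (\<Sum>i<N. a i u * b i v)) \<and>
    cobr f = (\<lambda>B. if bilinear_form_on fscale V B then \<Sum>i<N. B (a i) (b i) else 0)"
proof -
  have "bracket_transpose br f \<in> form_square V"
    using assms good_V by (auto simp: good_subspace_def)
  then obtain N :: nat and a b where ab: "\<forall>i<N. a i \<in> V \<and> b i \<in> V"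
    "bracket_transpose br f = (\<lambda>u v. \<Sum>i<N. a i u * b i v)"
    using form_square_rep[OF V_subspace] by blast
  have "cobr f = (\<lambda>B. if bilinear_form_on fscale V B then \<Sum>i<N. B (a i) (b i) else 0)"
    by (rule dual_cobracket_eqI[OF V_subspace])
      (use ab in \<open>auto intro!: tensor_square_sum simp: tensor_to_form_rep\<close>)
  moreover have "f (br u v) = (\<Sum>i<N. a i u * b i v)" for u v
    using fun_cong[OF fun_cong[OF ab(2), of u], of v] by (simp add: bracket_transpose_def)
  ultimately show ?thesis using ab by blast
qed

lemma cobr_mem: "f \<in> V \<Longrightarrow> cobr f \<in> tensor_square fscale V"
  and cobr_form: "f \<in> V \<Longrightarrow> tensor_to_form (cobr f) = bracket_transpose br f"
proof -
  assume "f \<in> V"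
  then obtain N :: nat and a b where ab: "\<forall>i<N. a i \<in> V \<and> b i \<in> V"
    "\<forall>u v. f (br u v) = (\<Sum>i<N. a i u * b i v)"
    "cobr f = (\<lambda>B. if bilinear_form_on fscale V B then \<Sum>i<N. B (a i) (b i) else 0)"
    using cobr_rep by blast
  show "cobr f \<in> tensor_square fscale V"
    unfolding ab(3) by (rule tensor_square_sum) (use ab in auto)
  show "tensor_to_form (cobr f) = bracket_transpose br f"
    by (simp add: ab tensor_to_form_rep bracket_transpose_def)
qed

text \<open>With one argument fixed, a decomposition of \<open>f (br u v)\<close> into products is a
  linear combination of factors from \<open>V\<close>. So \<open>V\<close> is stable under the
  coadjoint action, which is what makes the dual bracket land in \<open>V\<close>.\<close>

lemma ad_V:
  assumes "f \<in> V"
  shows "(\<lambda>u. f (br u v)) \<in> V" "(\<lambda>u. f (br v u)) \<in> V"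
proof -
  obtain N :: nat and a b where ab: "\<forall>i<N. a i \<in> V \<and> b i \<in> V"
    "\<forall>u v. f (br u v) = (\<Sum>i<N. a i u * b i v)"
    using cobr_rep[OF assms] by blast
  have "(\<lambda>u. f (br u v)) = (\<lambda>u. \<Sum>i<N. b i v * a i u)"
    "(\<lambda>u. f (br v u)) = (\<lambda>u. \<Sum>i<N. a i v * b i u)"
    by (simp_all add: ab(2) mult.commute)
  then show "(\<lambda>u. f (br u v)) \<in> V" "(\<lambda>u. f (br v u)) \<in> V"
    using ab(1) by (auto intro!: fun_sum_in_subspace V_subspace)
qed

lemma cobr_linear:
  assumes "f \<in> V" "g \<in> V"
  shows "cobr (f + g) = cobr f + cobr g" "cobr (fscale c f) = fscale c (cobr f)"
proof -
  have form: "cobr h (\<lambda>f g. f u * g v) = h (br u v)" if "h \<in> V" for h u v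
    using fun_cong[OF fun_cong[OF cobr_form[OF that], of u], of v]
    by (simp add: tensor_to_form_def bracket_transpose_def)
  show "cobr (f + g) = cobr f + cobr g"
  proof (rule dual_cobracket_eqI[OF V_subspace])
    show "tensor_to_form (cobr f + cobr g) = bracket_transpose br (f + g)"
      by (simp add: tensor_to_form_def bracket_transpose_def form assms)
  qed (intro tensor_square_closed cobr_mem assms)
  show "cobr (fscale c f) = fscale c (cobr f)"
  proof (rule dual_cobracket_eqI[OF V_subspace])
    show "tensor_to_form (fscale c (cobr f)) = bracket_transpose br (fscale c f)"
      by (simp add: tensor_to_form_def bracket_transpose_def fscale_def form assms)
  qed (intro tensor_square_closed cobr_mem assms)
qed

lemma cobr_skew:
  assumes "f \<in> V"
  shows "tensor_flip (cobr f) = - cobr f"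
proof -
  obtain N :: nat and a b where ab: "\<forall>i<N. a i \<in> V \<and> b i \<in> V"
    "\<forall>u v. f (br u v) = (\<Sum>i<N. a i u * b i v)"
    "cobr f = (\<lambda>B. if bilinear_form_on fscale V B then \<Sum>i<N. B (a i) (b i) else 0)"
    using cobr_rep[OF assms] by blast
  have flip: "tensor_flip (cobr f)
      = (\<lambda>B. if bilinear_form_on fscale V B then \<Sum>i<N. B (b i) (a i) else 0)"
  proof
    fix B :: "('v \<Rightarrow> 'f) \<Rightarrow> ('v \<Rightarrow> 'f) \<Rightarrow> 'f"
    show "tensor_flip (cobr f) B = (if bilinear_form_on fscale V B then \<Sum>i<N. B (b i) (a i) else 0)"
      unfolding tensor_flip_def ab(3)
      by (rule if_cong[OF bilinear_form_on_flip]) simp_all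
  qed
  have *: "(\<Sum>i<N. b i u * a i v) = - f (br u v)" for u v
    using ab(2)[rule_format, of v u] br_skew[of u v] V_linear(3)[OF assms, of "br v u"]
    by (simp add: mult.commute)
  show ?thesis
  proof (rule tensor_eqI[OF V_subspace])
    show "tensor_flip (cobr f) \<in> tensor_square fscale V"
      unfolding flip by (rule tensor_square_sum) (use ab in auto)
    show "- cobr f \<in> tensor_square fscale V"
      by (intro tensor_square_closed cobr_mem assms)
    have "tensor_to_form (- cobr f) = - bracket_transpose br f"
      using cobr_form[OF assms] by (simp add: tensor_to_form_def fun_eq_iff)
    then show "tensor_to_form (tensor_flip (cobr f)) = tensor_to_form (- cobr f)"
      unfolding flip tensor_to_form_rep * by (simp add: fun_eq_iff bracket_transpose_def)
  qed
qed

text \<open>The transpose of the Jacobi identity: as a function of three vectors,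
  \<open>(1 \<otimes> cobr) (cobr f)\<close> is \<open>f (br u (br v w))\<close>, and its cyclic sum
  is 0.\<close>

lemma co_jacobi:
  assumes f: "f \<in> V" and M: "trilinear_form_on fscale V M"
  shows "cobr f (\<lambda>b c. cobr c (\<lambda>d e. M b d e + M d e b + M e b d)) = 0"
proof -
  \<comment> \<open>Decompositions are chosen for all elements of \<open>V\<close> at once, because
    the cobracket is applied again to the right factors of \<open>cobr f\<close>.\<close>
  define P where "P = (\<lambda>f N a b. (\<forall>i<N::nat. a i \<in> V \<and> b i \<in> V) \<and>
    (\<forall>u v. f (br u v) = (\<Sum>i<N. a i u * b i v)) \<and>
    cobr f = (\<lambda>B. if bilinear_form_on fscale V B then \<Sum>i<N. B (a i) (b i) else 0))"
  have "\<forall>f\<in>V. \<exists>N a b. P f N a b"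
    unfolding P_def using cobr_rep by blast
  then obtain N a b where P: "\<And>f. f \<in> V \<Longrightarrow> P f (N f) (a f) (b f)"
    by metis
  have ab: "a f i \<in> V" "b f i \<in> V" if "f \<in> V" "i < N f" for f i
    using P[OF that(1)] that(2) unfolding P_def by blast+
  have form: "f (br u v) = (\<Sum>i<N f. a f i u * b f i v)" if "f \<in> V" for f u v
    using P[OF that] unfolding P_def by blast
  have cobr: "cobr f B = (\<Sum>i<N f. B (a f i) (b f i))"
    if "f \<in> V" "bilinear_form_on fscale V B" for f B
    using P[OF that(1)] that(2) unfolding P_def by simp
  define M' where "M' = (\<lambda>b d e. M b d e + M d e b + M e b d)"
  have bil: "bilinear_form_on fscale V (M' x)" if "x \<in> V" for x
    using M that unfolding M'_def trilinear_form_on_def bilinear_form_on_def bilinear_on_def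
    by (simp add: algebra_simps)
  have M'1: "M' (x + y) d e = M' x d e + M' y d e" "M' (fscale c x) d e = c * M' x d e"
    if "x \<in> V" "y \<in> V" "d \<in> V" "e \<in> V" for x y d e c
    using M that unfolding M'_def trilinear_form_on_def bilinear_form_on_def bilinear_on_def
    by (simp_all add: algebra_simps)
  \<comment> \<open>A tensor takes the default value 0 off the bilinear forms, so the outer
    \<open>cobr f\<close> can be expanded only after this. Linearity on the left is
    \<open>M'1\<close>, on the right \<open>cobr_linear\<close>.\<close>
  have bil2: "bilinear_form_on fscale V (\<lambda>x y. cobr y (M' x))"
  proof -
    have "cobr (x + y) (M' z) = cobr x (M' z) + cobr y (M' z)"
      "cobr (fscale c x) (M' z) = c * cobr x (M' z)" if "x \<in> V" "y \<in> V" for x y z c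
      using cobr_linear[OF that] by (simp_all add: fscale_def)
    moreover have "cobr z (M' (x + y)) = cobr z (M' x) + cobr z (M' y)"
      "cobr z (M' (fscale c x)) = c * cobr z (M' x)" if "x \<in> V" "y \<in> V" "z \<in> V" for x y z c
      using that ab fun_space.subspace_add[OF V_subspace] fun_space.subspace_scale[OF V_subspace]
      by (simp_all add: cobr bil M'1 sum.distrib sum_distrib_left)
    ultimately show ?thesis by (simp add: bilinear_form_on_def bilinear_on_def)
  qed
  \<comment> \<open>An index is a term of \<open>cobr f\<close> together with a term of the
    cobracket of its right factor.\<close>
  define K where "K = (SIGMA i:{..<N f}. {..<N (b f i)})"
  define x where "x = (\<lambda>t::nat \<times> nat. a f (fst t))"
  define y where "y = (\<lambda>t::nat \<times> nat. a (b f (fst t)) (snd t))"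
  define z where "z = (\<lambda>t::nat \<times> nat. b (b f (fst t)) (snd t))"
  have sum_K: "(\<Sum>t\<in>K. g (fst t) (snd t)) = (\<Sum>i<N f. \<Sum>j<N (b f i). g i j)"
    for g :: "nat \<Rightarrow> nat \<Rightarrow> 'f"
    unfolding K_def by (subst sum.Sigma) (auto simp: case_prod_unfold)
  have cubic: "(\<Sum>t\<in>K. x t u * y t v * z t w) = f (br u (br v w))" for u v w
    unfolding x_def y_def z_def sum_K[of "\<lambda>i j. a f i u * a (b f i) j v * b (b f i) j w"]
    using ab f by (simp add: form sum_distrib_left mult.assoc)
  have "cobr f (\<lambda>b c. cobr c (M' b)) = (\<Sum>i<N f. cobr (b f i) (M' (a f i)))"
    by (rule cobr[OF f bil2])
  also have "\<dots> = (\<Sum>i<N f. \<Sum>j<N (b f i). M' (a f i) (a (b f i) j) (b (b f i) j))"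
    using ab f by (intro sum.cong refl cobr bil) auto
  also have "\<dots> = (\<Sum>t\<in>K. M' (x t) (y t) (z t))"
    unfolding x_def y_def z_def by (rule sum_K[symmetric])
  also have "\<dots> = (\<Sum>t\<in>K. M (x t) (y t) (z t) + M (y t) (z t) (x t) + M (z t) (x t) (y t))"
    by (simp add: M'_def)
  also have "\<dots> = 0"
  proof (rule trilinear_cyclic_sum_eq_0[OF V_subspace M])
    show "finite K" by (simp add: K_def)
    show "x t \<in> V \<and> y t \<in> V \<and> z t \<in> V" if "t \<in> K" for t
      using that ab f by (auto simp: K_def x_def y_def z_def)
    fix u v w
    have "(\<Sum>t\<in>K. x t u * y t v * z t w + y t u * z t v * x t w + z t u * x t v * y t w)
      = (\<Sum>t\<in>K. x t u * y t v * z t w) + (\<Sum>t\<in>K. x t w * y t u * z t v)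
        + (\<Sum>t\<in>K. x t v * y t w * z t u)"
      by (simp add: sum.distrib mult_ac)
    also have "\<dots> = f (br u (br v w) + br v (br w u) + br w (br u v))"
      by (simp add: cubic V_linear[OF f])
    finally show "(\<Sum>t\<in>K. x t u * y t v * z t w + y t u * z t v * x t w + z t u * x t v * y t w) = 0"
      by (simp add: jacobi V_linear[OF f])
  qed
  finally show ?thesis by (simp add: M'_def)
qed

lemma dual_lie_coalgebra: "lie_coalgebra fscale V cobr"
  unfolding lie_coalgebra_def
  using fun_space.vector_space_axioms V_subspace cobr_mem cobr_linear cobr_skew co_jacobi
  by blast

end

section \<open>Coboundary structures from a rank two r-matrix\<close>

text \<open>No relation between \<open>X\<close> and \<open>Y\<close> is built in. Whether
  \<open>[X, Y] = Y\<close> holds in the algebra or only under the functionals of the dual is left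
  to the individual lemmas, so that one locale serves both algebras and all
  \<open>n\<close>.\<close>

locale lie_alg_r = lie_alg s br for s :: "'f::field \<Rightarrow> 'v::ab_group_add \<Rightarrow> 'v" and br +
  fixes X Y :: 'v
begin

definition "r_mat = pure_tensor s UNIV X Y - pure_tensor s UNIV Y X"

definition "delta u = tensor_act s UNIV br u r_mat"

lemma r_mat_mem: "r_mat \<in> tensor_square s UNIV"
  unfolding r_mat_def by (intro tensor_square_closed) auto

lemma r_mat_apply: "bilinear_form_on s UNIV B \<Longrightarrow> r_mat B = B X Y - B Y X"
  by (simp add: r_mat_def pure_tensor_def)

lemma bilinear_form_act:
  "bilinear_form_on s UNIV B \<Longrightarrow> bilinear_form_on s UNIV (\<lambda>a b. B (br u a) b + B a (br u b))"
  by (simp add: bilinear_form_on_def bilinear_on_def br_linear algebra_simps)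

lemma delta_apply:
  "delta u B = (if bilinear_form_on s UNIV B
    then B (br u X) Y + B X (br u Y) - B (br u Y) X - B Y (br u X) else 0)"
  by (simp add: delta_def tensor_act_def bilinear_form_act r_mat_apply)

lemma delta_eq:
  "delta u = pure_tensor s UNIV (br u X) Y + pure_tensor s UNIV X (br u Y)
    - pure_tensor s UNIV (br u Y) X - pure_tensor s UNIV Y (br u X)"
  by (simp add: fun_eq_iff delta_apply pure_tensor_def)

lemma delta_mem: "delta u \<in> tensor_square s UNIV"
  unfolding delta_eq by (intro tensor_square_closed) auto

lemma bilinear_formD:
  assumes "bilinear_form_on s UNIV B"
  shows "B (a + b) c = B a c + B b c" "B c (a + b) = B c a + B c b"
    "B (s t a) b = t * B a b" "B a (s t b) = t * B a b"
    "B (- a) b = - B a b" "B a (- b) = - B a b" "B 0 a = 0" "B a 0 = 0"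
    "B (a - b) c = B a c - B b c" "B c (a - b) = B c a - B c b"
proof -
  interpret vector_space s by (rule vs)
  show add: "B (a + b) c = B a c + B b c" "B c (a + b) = B c a + B c b" for a b c
    using assms by (auto simp: bilinear_form_on_def bilinear_on_def)
  show scale: "B (s t a) b = t * B a b" "B a (s t b) = t * B a b" for a b t
    using assms by (auto simp: bilinear_form_on_def bilinear_on_def)
  have s: "s 0 a = 0" "s (- 1) a = - a" for a
    by simp_all
  show "B 0 a = 0" "B a 0 = 0" for a
    using scale(1)[of 0 a a] scale(2)[of a 0 a] by (simp_all add: s)
  show neg: "B (- a) b = - B a b" "B a (- b) = - B a b" for a b
    using scale(1)[of "-1" a b] scale(2)[of a "-1" b] by (simp_all add: s)
  show "B (a - b) c = B a c - B b c" "B c (a - b) = B c a - B c b"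
    using add(1)[of a "- b" c] add(2)[of c a "- b"] by (simp_all add: neg)
qed

lemma trilinear_formD:
  assumes "trilinear_form_on s UNIV M"
  shows "M (a + b) c d = M a c d + M b c d" "M c (a + b) d = M c a d + M c b d"
    "M c d (a + b) = M c d a + M c d b"
    "M (s t a) c d = t * M a c d" "M c (s t a) d = t * M c a d" "M c d (s t a) = t * M c d a"
    "M (- a) c d = - M a c d" "M c (- a) d = - M c a d" "M c d (- a) = - M c d a"
    "M (a - b) c d = M a c d - M b c d" "M c (a - b) d = M c a d - M c b d"
    "M c d (a - b) = M c d a - M c d b"
    "M 0 c d = 0" "M c 0 d = 0" "M c d 0 = 0"
proof -
  have "bilinear_form_on s UNIV (\<lambda>a b. M a b c)" "bilinear_form_on s UNIV (\<lambda>b d. M c b d)" for c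
    using assms by (auto simp: trilinear_form_on_def)
  note * = bilinear_formD[OF this(1)] bilinear_formD[OF this(2)]
  show "M (a + b) c d = M a c d + M b c d" "M c (a + b) d = M c a d + M c b d"
    "M c d (a + b) = M c d a + M c d b"
    "M (s t a) c d = t * M a c d" "M c (s t a) d = t * M c a d" "M c d (s t a) = t * M c d a"
    "M (- a) c d = - M a c d" "M c (- a) d = - M c a d" "M c d (- a) = - M c d a"
    "M (a - b) c d = M a c d - M b c d" "M c (a - b) d = M c a d - M c b d"
    "M c d (a - b) = M c d a - M c d b"
    "M 0 c d = 0" "M c 0 d = 0" "M c d 0 = 0"
    by (rule *)+
qed

text \<open>A coboundary is a cocycle: on \<open>r_mat\<close>, acting by \<open>br u v\<close> is
  the commutator of the actions of \<open>u\<close> and \<open>v\<close>, by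
  \<open>br_br\<close>.\<close>

lemma delta_cocycle: "delta (br u v) = tensor_act s UNIV br u (delta v) - tensor_act s UNIV br v (delta u)"
proof
  fix B
  show "delta (br u v) B = (tensor_act s UNIV br u (delta v) - tensor_act s UNIV br v (delta u)) B"
  proof (cases "bilinear_form_on s UNIV B")
    case True
    show ?thesis
      by (simp add: tensor_act_def delta_apply True bilinear_form_act br_br bilinear_formD[OF True])
  qed (simp add: tensor_act_def delta_apply)
qed

text \<open>Inherited from the antisymmetry of \<open>r_mat\<close>. Swapping arguments preserves
  bilinearity in both directions, so the default values agree as well.\<close>

lemma delta_skew: "tensor_flip (delta u) = - delta u"
proof
  fix B :: "'v \<Rightarrow> 'v \<Rightarrow> 'f"
  show "tensor_flip (delta u) B = (- delta u) B"
  proof (cases "bilinear_form_on s UNIV B")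
    case True
    then have "bilinear_form_on s UNIV (\<lambda>a b. B b a)"
      by (rule iffD2[OF bilinear_form_on_flip])
    with True show ?thesis by (simp add: tensor_flip_def delta_apply)
  next
    case False
    then have "\<not> bilinear_form_on s UNIV (\<lambda>a b. B b a)"
      by (rule contrapos_nn) (rule iffD1[OF bilinear_form_on_flip])
    with False show ?thesis by (simp add: tensor_flip_def delta_apply)
  qed
qed

text \<open>
  \<open>[X, Y] = Y\<close> is only needed up to an element \<open>z\<close> that \<open>M\<close> ignores. In the Virasoro algebra
  \<open>z\<close> is a multiple of the central element, on which all functionals in the dual vanish.
\<close>

lemma delta_co_jacobi:
  assumes M: "trilinear_form_on s UNIV M" and XY: "br X Y = Y + z"
    and z: "\<And>a b. M z a b = 0" "\<And>a b. M a z b = 0" "\<And>a b. M a b z = 0"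
      "\<And>u a b. M (br u z) a b = 0" "\<And>u a b. M a (br u z) b = 0" "\<And>u a b. M a b (br u z) = 0"
  shows "delta u (\<lambda>b c. delta c (\<lambda>d e. M b d e + M d e b + M e b d)) = 0"
proof -
  note M' = trilinear_formD[OF M]
  define P Q where "P = br u X" and "Q = br u Y"
  have YX: "br Y X = - (Y + z)" using br_skew[of Y X] XY by simp
  \<comment> \<open>The Jacobi identity for \<open>u\<close>, \<open>X\<close>, \<open>Y\<close>. It
    eliminates \<open>br Q X\<close>, the only dependency among the brackets that occur; after that
    the terms cancel formally.\<close>
  have QX: "br Q X = br P Y - Q - br u z"
    using br_br[of u Y X] br_br[of u X Y] br_skew[of Y "br u X"] br_skew[of X "br u Y"]
    by (simp add: P_def Q_def XY YX br_linear br_minus)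
  have bil: "bilinear_form_on s UNIV (\<lambda>d e. M b d e + M d e b + M e b d)" for b
    by (simp add: bilinear_form_on_def bilinear_on_def M' algebra_simps)
  have "bilinear_form_on s UNIV (\<lambda>b c. delta c (\<lambda>d e. M b d e + M d e b + M e b d))"
    unfolding delta_apply if_P[OF bil]
    by (simp add: bilinear_form_on_def bilinear_on_def M' br_linear algebra_simps)
  then show ?thesis
    unfolding delta_apply if_P[OF bil] P_def[symmetric] Q_def[symmetric]
    by (simp add: M' XY YX QX z br_self)
qed

text \<open>Only brackets among \<open>X\<close> and \<open>Y\<close> occur. They are 0 or
  \<open>Y\<close> up to sign, and the remaining terms cancel in pairs.\<close>

lemma cybe_r_mat:
  assumes XY: "br X Y = Y"
  shows "cybe s UNIV br r_mat"
  unfolding cybe_def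
proof (intro allI impI)
  fix M :: "'v \<Rightarrow> 'v \<Rightarrow> 'v \<Rightarrow> 'f"
  assume "trilinear_form_on s UNIV M"
  note M' = trilinear_formD[OF this]
  have YX: "br Y X = - Y" using br_skew[of Y X] XY by simp
  \<comment> \<open>Both nested evaluations of \<open>r_mat\<close> need a bilinear argument;
    otherwise they would return the default value 0.\<close>
  have 1: "bilinear_form_on s UNIV (\<lambda>c d. M (br a c) b d + M a (br b c) d + M a c (br b d))" for a b
    by (simp add: bilinear_form_on_def bilinear_on_def M' br_linear algebra_simps)
  have 2: "bilinear_form_on s UNIV
    (\<lambda>a b. r_mat (\<lambda>c d. M (br a c) b d + M a (br b c) d + M a c (br b d)))"
    unfolding r_mat_apply[OF 1]
    by (simp add: bilinear_form_on_def bilinear_on_def M' br_linear algebra_simps)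
  show "r_mat (\<lambda>a b. r_mat (\<lambda>c d. M (br a c) b d + M a (br b c) d + M a c (br b d))) = 0"
    unfolding r_mat_apply[OF 1] r_mat_apply[OF 2[unfolded r_mat_apply[OF 1]]] by (simp add: XY YX br_self M')
qed

lemma triangular_lie_bialgebra_delta:
  assumes XY: "br X Y = Y"
  shows "triangular_lie_bialgebra s UNIV br delta r_mat"
proof -
  interpret vector_space s by (rule vs)
  have "delta (a + b) = delta a + delta b" "delta (s t a) = fscale t (delta a)" for a b t
    by (auto simp: fun_eq_iff delta_apply fscale_def br_linear bilinear_formD algebra_simps)
  moreover have "module.subspace s UNIV"
    by (rule subspace_UNIV)
  moreover have "delta u (\<lambda>b c. delta c (\<lambda>d e. M b d e + M d e b + M e b d)) = 0"
    if "trilinear_form_on s UNIV M" for M u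
    by (rule delta_co_jacobi[OF that, of 0]) (simp_all add: XY trilinear_formD[OF that] br_zero)
  ultimately have "lie_coalgebra s UNIV delta"
    using vs delta_mem delta_skew by (simp add: lie_coalgebra_def)
  then show ?thesis
    using lie cybe_r_mat[OF XY] r_mat_mem delta_cocycle
    by (simp add: triangular_lie_bialgebra_def coboundary_lie_bialgebra_def lie_bialgebra_def
        delta_def)
qed

section \<open>The bracket on the dual and its compatibility with the cobracket\<close>

lemma bilinear_form_prod:
  assumes "f \<in> full_dual s" "g \<in> full_dual s"
  shows "bilinear_form_on s UNIV (\<lambda>a b. f a * g b)"
  using assms by (simp add: full_dual_iff[OF vs] bilinear_form_on_def bilinear_on_def algebra_simps)

lemma V_full_dual: "f \<in> V \<Longrightarrow> f \<in> full_dual s"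
  using good_V by (auto simp: good_subspace_def)

lemma dual_bracket_apply:
  assumes "f \<in> full_dual s" "g \<in> full_dual s"
  shows "dual_bracket delta f g u
    = f (br u X) * g Y + f X * g (br u Y) - f (br u Y) * g X - f Y * g (br u X)"
  by (simp add: dual_bracket_def delta_apply bilinear_form_prod assms)

text \<open>For this r-matrix the bracket of \<open>f\<close> and \<open>g\<close> is a combination
  of their coadjoint translates by \<open>X\<close> and \<open>Y\<close>, and \<open>ad_V\<close>
  applies.\<close>

lemma dual_bracket_mem:
  assumes "f \<in> V" "g \<in> V"
  shows "dual_bracket delta f g \<in> V"
proof -
  have "dual_bracket delta f g = fscale (g Y) (\<lambda>u. f (br u X)) + fscale (f X) (\<lambda>u. g (br u Y))
      - fscale (g X) (\<lambda>u. f (br u Y)) - fscale (f Y) (\<lambda>u. g (br u X))"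
    by (rule ext) (simp add: dual_bracket_apply V_full_dual assms fscale_def)
  also have "\<dots> \<in> V"
    by (intro fun_space.subspace_diff fun_space.subspace_add fun_space.subspace_scale V_subspace
        ad_V assms)
  finally show ?thesis .
qed

text \<open>The Jacobi identity is the co-Jacobi identity of \<open>delta\<close> paired with three
  functionals. Compatibility is compared on pairs of vectors, where it comes down to
  \<open>br_br\<close>.\<close>

lemma dual_lie_bialgebra:
  assumes XY: "\<And>f. f \<in> V \<Longrightarrow> f (br X Y) = f Y"
  shows "lie_bialgebra fscale V (dual_bracket delta) cobr"
proof -
  define db where "db = dual_bracket delta"
  note db_apply = dual_bracket_apply[OF V_full_dual V_full_dual, folded db_def]
  note db_mem = dual_bracket_mem[folded db_def]
  note V_add = fun_space.subspace_add[OF V_subspace]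
  note V_scale = fun_space.subspace_scale[OF V_subspace]
  have db_linear: "db (f + g) h = db f h + db g h" "db h (f + g) = db h f + db h g"
    "db (fscale t f) g = fscale t (db f g)" "db f (fscale t g) = fscale t (db f g)"
    if "f \<in> V" "g \<in> V" "h \<in> V" for f g h t
    using that by (auto simp: fun_eq_iff db_apply V_add V_scale fscale_apply algebra_simps)
  have jac: "db f (db g h) + db g (db h f) + db h (db f g) = 0"
    if f: "f \<in> V" and g: "g \<in> V" and h: "h \<in> V" for f g h
  proof
    fix u
    \<comment> \<open>The defect of \<open>[X, Y] = Y\<close>. Functionals in \<open>V\<close> kill
      it, and also every \<open>br v z\<close>, because \<open>V\<close> is stable under the
      coadjoint action.\<close>
    define z where "z = br X Y - Y"
    have z: "k z = 0" "k (br v z) = 0" if "k \<in> V" for k v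
      using XY[OF that] XY[OF ad_V(2)[OF that, of v]] V_linear[OF that]
      by (simp_all add: z_def br_linear br_minus diff_conv_add_uminus del: add_uminus_conv_diff)
    \<comment> \<open>The form \<open>f \<otimes> g \<otimes> h\<close>. Its cyclic sum turns the
      inner evaluation of \<open>delta\<close> into the brackets \<open>db g h\<close>,
      \<open>db f g\<close> and \<open>db h f\<close>, and the outer one into the three terms of the
      Jacobi identity.\<close>
    define M where "M = (\<lambda>b d e. f b * g d * h e)"
    have M: "trilinear_form_on s UNIV M"
      by (simp add: trilinear_form_on_def bilinear_form_on_def bilinear_on_def M_def
          V_linear[OF f] V_linear[OF g] V_linear[OF h] algebra_simps)
    have coj: "delta u (\<lambda>b c. delta c (\<lambda>d e. M b d e + M d e b + M e b d)) = 0"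
      by (rule delta_co_jacobi[OF M, of z]) (use z f g h in \<open>simp_all add: M_def z_def\<close>)
    have inner: "delta c (\<lambda>d e. M b d e + M d e b + M e b d)
      = f b * db g h c + h b * db f g c + g b * db h f c" for b c
    proof -
      have "bilinear_form_on s UNIV (\<lambda>d e. M b d e + M d e b + M e b d)"
        by (simp add: bilinear_form_on_def bilinear_on_def trilinear_formD[OF M] algebra_simps)
      then show ?thesis
        unfolding delta_apply if_P by (simp add: M_def db_apply f g h algebra_simps)
    qed
    have bil: "bilinear_form_on s UNIV (\<lambda>b c. f b * db g h c + h b * db f g c + g b * db h f c)"
      by (simp add: bilinear_form_on_def bilinear_on_def algebra_simps V_linear[OF f] V_linear[OF g]
          V_linear[OF h] V_linear[OF db_mem[OF g h]] V_linear[OF db_mem[OF f g]]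
          V_linear[OF db_mem[OF h f]])
    show "(db f (db g h) + db g (db h f) + db h (db f g)) u = 0 u"
      using coj[unfolded inner delta_apply if_P[OF bil]]
      by (simp add: db_apply[OF _ db_mem] f g h algebra_simps)
  qed
  have lie: "lie_algebra fscale V db"
    using fun_space.vector_space_axioms V_subspace db_mem db_linear jac
    by (auto simp: lie_algebra_def bilinear_on_def fun_eq_iff[of "db _ _" 0] db_apply)
  have "cobr (db f g) = tensor_act fscale V db f (cobr g) - tensor_act fscale V db g (cobr f)"
    if f: "f \<in> V" and g: "g \<in> V" for f g
  proof (rule dual_cobracket_eqI[OF V_subspace])
    \<comment> \<open>When \<open>db f\<close> acts on one factor of \<open>cobr g\<close>, the sum
      over the decomposition reassembles into \<open>g (br q v)\<close> or
      \<open>g (br u q)\<close>, so the result is independent of the decomposition.\<close>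
    have act: "tensor_act fscale V db f (cobr g) \<in> tensor_square fscale V \<and>
      (\<forall>u v. tensor_to_form (tensor_act fscale V db f (cobr g)) u v =
        delta u (\<lambda>p q. f p * g (br q v)) + delta v (\<lambda>p q. f p * g (br u q)))"
      if f: "f \<in> V" and g: "g \<in> V" for f g
    proof -
      obtain N :: nat and a b where ab: "\<forall>i<N. a i \<in> V \<and> b i \<in> V"
        "\<forall>u v. g (br u v) = (\<Sum>i<N. a i u * b i v)"
        "cobr g = (\<lambda>B. if bilinear_form_on fscale V B then \<Sum>i<N. B (a i) (b i) else 0)"
        using cobr_rep[OF g] by blast
      have bil: "bilinear_form_on fscale V (\<lambda>a b. B (db f a) b + B a (db f b))"
        if "bilinear_form_on fscale V B" for B
        using that f by (simp add: bilinear_form_on_def bilinear_on_def db_linear db_mem algebra_simps)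
      have T: "tensor_act fscale V db f (cobr g) = (\<lambda>B. if bilinear_form_on fscale V B
          then \<Sum>i<N. B (db f (a i)) (b i) + B (a i) (db f (b i)) else 0)"
        by (simp add: tensor_act_def ab(3) bil fun_eq_iff)
      have "tensor_act fscale V db f (cobr g)
        = (\<Sum>i<N. pure_tensor fscale V (db f (a i)) (b i) + pure_tensor fscale V (a i) (db f (b i)))"
        unfolding T by (auto simp: fun_eq_iff sum_apply pure_tensor_def)
      also have "\<dots> \<in> tensor_square fscale V"
        using ab(1) f db_mem by (auto intro!: tensor_square_closed)
      finally have "tensor_act fscale V db f (cobr g) \<in> tensor_square fscale V" .
      moreover have "tensor_to_form (tensor_act fscale V db f (cobr g)) u v =
        delta u (\<lambda>p q. f p * g (br q v)) + delta v (\<lambda>p q. f p * g (br u q))" for u v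
      proof -
        have "(\<Sum>i<N. db f (a i) u * b i v) = (\<Sum>i<N. (f (br u X) * a i Y + f X * a i (br u Y)
            - f (br u Y) * a i X - f Y * a i (br u X)) * b i v)"
          by (intro sum.cong refl) (use ab(1) f in \<open>simp add: db_apply\<close>)
        also have "\<dots> = delta u (\<lambda>p q. f p * g (br q v))"
          unfolding delta_apply
            if_P[OF bilinear_form_prod[OF V_full_dual[OF f] V_full_dual[OF ad_V(1)[OF g]]]]
          by (simp add: ab(2) sum_distrib_left sum.distrib sum_subtractf algebra_simps)
        finally have 1: "delta u (\<lambda>p q. f p * g (br q v)) = (\<Sum>i<N. db f (a i) u * b i v)" ..
        have "(\<Sum>i<N. a i u * db f (b i) v) = (\<Sum>i<N. a i u * (f (br v X) * b i Y
            + f X * b i (br v Y) - f (br v Y) * b i X - f Y * b i (br v X)))"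
          by (intro sum.cong refl) (use ab(1) f in \<open>simp add: db_apply\<close>)
        also have "\<dots> = delta v (\<lambda>p q. f p * g (br u q))"
          unfolding delta_apply
            if_P[OF bilinear_form_prod[OF V_full_dual[OF f] V_full_dual[OF ad_V(2)[OF g]]]]
          by (simp add: ab(2) sum_distrib_left sum.distrib sum_subtractf algebra_simps)
        finally have 2: "delta v (\<lambda>p q. f p * g (br u q)) = (\<Sum>i<N. a i u * db f (b i) v)" ..
        show ?thesis
          by (simp add: tensor_to_form_def T bilinear_form_on_eval 1 2 sum.distrib)
      qed
      ultimately show ?thesis by blast
    qed
    show "tensor_act fscale V db f (cobr g) - tensor_act fscale V db g (cobr f) \<in> tensor_square fscale V"
      using act f g by (intro tensor_square_closed) auto
    have bil: "bilinear_form_on s UNIV (\<lambda>p q. f p * g (br q v))"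
      "bilinear_form_on s UNIV (\<lambda>p q. f p * g (br v q))" if "f \<in> V" "g \<in> V" for f g v
      using bilinear_form_prod[OF V_full_dual[OF that(1)] V_full_dual[OF ad_V(1)[OF that(2)]]]
        bilinear_form_prod[OF V_full_dual[OF that(1)] V_full_dual[OF ad_V(2)[OF that(2)]]]
      by auto
    have V_diff: "k (a - b) = k a - k b" if "k \<in> V" for k a b
      using V_linear(1)[OF that, of a "- b"] V_linear(3)[OF that, of b] by simp
    show "tensor_to_form (tensor_act fscale V db f (cobr g) - tensor_act fscale V db g (cobr f))
      = bracket_transpose br (db f g)"
    proof (intro ext)
      fix u v
      have "tensor_to_form (tensor_act fscale V db f (cobr g) - tensor_act fscale V db g (cobr f)) u v
        = (delta u (\<lambda>p q. f p * g (br q v)) + delta v (\<lambda>p q. f p * g (br u q)))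
          - (delta u (\<lambda>p q. g p * f (br q v)) + delta v (\<lambda>p q. g p * f (br u q)))"
        using act[OF f g] act[OF g f] by (simp add: tensor_to_form_def)
      also have "\<dots> = db f g (br u v)"
        unfolding delta_apply bil[OF f g, THEN if_P] bil[OF g f, THEN if_P]
        by (simp add: f g db_apply br_br[of u v] br_skew[of X v] br_skew[of Y v]
            br_skew[of "br u X" v] br_skew[of "br u Y" v] V_linear[OF f] V_linear[OF g] V_diff
            algebra_simps)
      finally show "tensor_to_form (tensor_act fscale V db f (cobr g)
          - tensor_act fscale V db g (cobr f)) u v = bracket_transpose br (db f g) u v"
        by (simp add: bracket_transpose_def)
    qed
  qed
  then show ?thesis
    using lie dual_lie_coalgebra unfolding lie_bialgebra_def db_def by blast
qed

end

section \<open>The Witt and Virasoro Lie algebras\<close>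

text \<open>Reduces additive identities on Laurent polynomials to monomials; 0 is covered as a
  monomial with coefficient 0.\<close>

lemma single_add_induct [case_names single add]:
  fixes p :: "'a \<Rightarrow>\<^sub>0 'b::comm_monoid_add"
  assumes single: "\<And>i c. P (Poly_Mapping.single i c)" and add: "\<And>p q. P p \<Longrightarrow> P q \<Longrightarrow> P (p + q)"
  shows "P p"
proof -
  have "P (\<Sum>i\<in>A. Poly_Mapping.single i (Poly_Mapping.lookup p i))" if "finite A" for A
    using that
  proof (induction A)
    case empty
    then show ?case using single[of _ 0] by simp
  qed (simp add: single add)
  moreover have "(\<Sum>i\<in>Poly_Mapping.keys p. Poly_Mapping.single i (Poly_Mapping.lookup p i)) = p"
  proof (rule poly_mapping_eqI)
    fix k
    have "Poly_Mapping.lookup (\<Sum>i\<in>Poly_Mapping.keys p. Poly_Mapping.single i (Poly_Mapping.lookup p i)) k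
      = (\<Sum>i\<in>Poly_Mapping.keys p. if i = k then Poly_Mapping.lookup p i else 0)"
      by (simp add: lookup_sum lookup_single when_def)
    also have "\<dots> = Poly_Mapping.lookup p k" by (simp add: sum.delta in_keys_iff)
    finally show "Poly_Mapping.lookup (\<Sum>i\<in>Poly_Mapping.keys p.
      Poly_Mapping.single i (Poly_Mapping.lookup p i)) k = Poly_Mapping.lookup p k" .
  qed
  ultimately show ?thesis using finite_keys by metis
qed

interpretation witt: vector_space witt_scale
  by unfold_locales
    (simp_all add: poly_mapping_eq_iff fun_eq_iff lookup_witt_scale lookup_add algebra_simps)

interpretation vir: vector_space vir_scale
  by unfold_locales (simp_all add: vir_scale_def prod_eq_iff algebra_simps
      witt.scale_right_distrib witt.scale_left_distrib)

lemma laurent_deriv_mult: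
  "laurent_deriv (p * q) = laurent_deriv p * q + p * laurent_deriv q"
proof (induction p rule: single_add_induct)
  case (single i c)
  show ?case
  proof (induction q rule: single_add_induct)
    case (single j d)
    have "i + j - 1 = i - 1 + j" "i + (j - 1) = i - 1 + j" by auto
    then show ?case
      by (simp add: mult_single laurent_deriv_single single_add[symmetric] algebra_simps)
  qed (simp add: laurent_deriv_add distrib_left algebra_simps)
qed (simp add: laurent_deriv_add distrib_right algebra_simps)

lemma laurent_deriv_diff: "laurent_deriv (p - q) = laurent_deriv p - laurent_deriv q"
  by (rule poly_mapping_eqI) (simp add: lookup_laurent_deriv lookup_minus algebra_simps)

text \<open>In a commutative ring, \<open>a D(b) - D(a) b\<close> satisfies the Jacobi identity for
  every derivation \<open>D\<close>.\<close>

lemma witt_jacobi: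
  "witt_bracket a (witt_bracket b c) + witt_bracket b (witt_bracket c a)
    + witt_bracket c (witt_bracket a b) = 0"
  by (simp add: witt_bracket_def laurent_deriv_diff laurent_deriv_mult algebra_simps)

lemma lie_algebra_witt: "lie_algebra witt_scale UNIV witt_bracket"
  using witt.vector_space_axioms
  by (simp add: lie_algebra_def bilinear_on_def witt_bracket_add witt_bracket_scale witt_jacobi)
    (simp add: witt_bracket_def)

lemma vir_cocycle_jacobi:
  fixes a b c :: "'f::field_char_0 witt"
  shows "vir_cocycle a (witt_bracket b c) + vir_cocycle b (witt_bracket c a)
    + vir_cocycle c (witt_bracket a b) = 0"
proof (induction a rule: single_add_induct)
  case a: (single i r)
  show ?case
  proof (induction b rule: single_add_induct)
    case b: (single j s)
    show ?case
    proof (induction c rule: single_add_induct)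
      case c: (single m t)
      \<comment> \<open>The bracket lowers the total exponent by one and the cocycle pairs exponents
        with sum 2, so only monomials of total exponent 3 contribute; there it is a polynomial
        identity in \<open>i\<close> and \<open>j\<close>.\<close>
      show ?case
      proof (cases "i + j + m = 3")
        case True
        then have m: "m = 3 - i - j" by simp
        show ?thesis
          by (simp add: witt_bracket_single vir_cocycle_single m)
            (simp add: power3_eq_cube field_simps)
      qed (simp add: witt_bracket_single vir_cocycle_single)
    next
      case (add p q)
      from arg_cong2[where f = "(+)", OF add] show ?case
        by (simp add: witt_bracket_add vir_cocycle_add algebra_simps)
    qed
  next
    case (add p q)
    from arg_cong2[where f = "(+)", OF add] show ?case
      by (simp add: witt_bracket_add vir_cocycle_add algebra_simps)
  qed
next
  case (add p q)
  from arg_cong2[where f = "(+)", OF add] show ?case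
    by (simp add: witt_bracket_add vir_cocycle_add algebra_simps)
qed

lemma lie_algebra_vir: "lie_algebra (vir_scale :: 'f::field_char_0 \<Rightarrow> _) UNIV vir_bracket"
proof -
  have "vir_bracket a (vir_bracket b c) + vir_bracket b (vir_bracket c a)
    + vir_bracket c (vir_bracket a b) = 0" for a b c :: "'f virasoro"
    using vir_cocycle_jacobi[of "fst a" "fst b" "fst c"]
    by (simp add: vir_bracket_def witt_jacobi prod_eq_iff)
  then show ?thesis
    using vir.vector_space_axioms
    by (simp add: lie_algebra_def bilinear_on_def vir_bracket_linear vir_bracket_self)
qed

section \<open>Functionals vanishing on a nonzero ideal of Laurent polynomials\<close>

lemma full_dual_witt:
  "f \<in> full_dual witt_scale \<longleftrightarrow> (\<forall>a b. f (a + b) = f a + f b) \<and> (\<forall>t a. f (witt_scale t a) = t * f a)"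
  by (rule full_dual_iff) (rule witt.vector_space_axioms)

lemma full_dual_vir:
  "f \<in> full_dual vir_scale \<longleftrightarrow> (\<forall>a b. f (a + b) = f a + f b) \<and> (\<forall>t a. f (vir_scale t a) = t * f a)"
  by (rule full_dual_iff) (rule vir.vector_space_axioms)

lemma full_dual_linear:
  assumes "vector_space s" "f \<in> full_dual s"
  shows "f (a + b) = f a + f b" "f (s t a) = t * f a" "f 0 = 0" "f (a - b) = f a - f b"
    "f (\<Sum>i\<in>A. g i) = (\<Sum>i\<in>A. f (g i))"
proof -
  show add: "f (a + b) = f a + f b" for a b using assms by (simp add: full_dual_iff)
  show "f (s t a) = t * f a" using assms by (simp add: full_dual_iff)
  have "f 0 + f 0 = f 0 + 0" using add[of 0 0] by simp
  then show 0: "f 0 = 0" by (simp only: add_left_cancel)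
  show "f (a - b) = f a - f b" using add[of "a - b" b] by simp
  show "f (\<Sum>i\<in>A. g i) = (\<Sum>i\<in>A. f (g i))"
    by (induction A rule: infinite_finite_induct) (simp_all add: 0 add)
qed

lemmas full_dual_witt_linear = full_dual_linear[OF witt.vector_space_axioms]
lemmas full_dual_vir_linear = full_dual_linear[OF vir.vector_space_axioms]

lemma witt_single: "Poly_Mapping.single i c = witt_scale c (witt_x i)"
  by (simp add: witt_x_def witt_scale_single)

lemma full_dual_witt_expand:
  assumes "f \<in> full_dual witt_scale" "finite A" "Poly_Mapping.keys p \<subseteq> A"
  shows "f p = (\<Sum>i\<in>A. Poly_Mapping.lookup p i * f (witt_x i))"
proof -
  have "p = (\<Sum>i\<in>A. Poly_Mapping.single i (Poly_Mapping.lookup p i))"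
  proof (rule poly_mapping_eqI)
    fix k
    have "(\<Sum>i\<in>A. Poly_Mapping.lookup (Poly_Mapping.single i (Poly_Mapping.lookup p i)) k)
      = (\<Sum>i\<in>A. if i = k then Poly_Mapping.lookup p i else 0)"
      by (simp add: lookup_single when_def)
    also have "\<dots> = Poly_Mapping.lookup p k"
      using assms by (auto simp: sum.delta in_keys_iff)
    finally show "Poly_Mapping.lookup p k
      = Poly_Mapping.lookup (\<Sum>i\<in>A. Poly_Mapping.single i (Poly_Mapping.lookup p i)) k"
      by (simp add: lookup_sum)
  qed
  then have "f p = f (\<Sum>i\<in>A. Poly_Mapping.single i (Poly_Mapping.lookup p i))"
    by (rule arg_cong)
  then show ?thesis
    by (simp add: full_dual_witt_linear[OF assms(1)] witt_single)
qed

lemma witt_x_mult: "witt_x i * witt_x j = witt_x (i + j)"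
  by (simp add: witt_x_def mult_single)

lemma lookup_witt_x_mult:
  "Poly_Mapping.lookup (witt_x t * p) i = Poly_Mapping.lookup p (i - t)"
  by (induction p rule: single_add_induct)
    (auto simp: witt_x_def mult_single lookup_single when_def distrib_left lookup_add)

lemma witt_scale_mult_left: "witt_scale c (p * q) = witt_scale c p * q"
  and witt_scale_mult_right: "witt_scale c (p * q) = p * witt_scale c q"
  by (simp_all add: witt_scale_mult mult.assoc mult.left_commute)

lemma full_dual_mult:
  assumes "f \<in> full_dual witt_scale"
  shows "(\<lambda>v. f (u * v)) \<in> full_dual witt_scale" "(\<lambda>v. f (v * u)) \<in> full_dual witt_scale"
  using full_dual_witt_linear[OF assms]
  by (simp_all add: full_dual_witt distrib_left distrib_right
      witt_scale_mult_left[symmetric] witt_scale_mult_right[symmetric])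

lemma full_dual_laurent_deriv:
  "f \<in> full_dual witt_scale \<Longrightarrow> (\<lambda>v. f (laurent_deriv v)) \<in> full_dual witt_scale"
  by (simp add: full_dual_witt laurent_deriv_add laurent_deriv_scale)

text \<open>The finite dual of the algebra of Laurent polynomials: a nonzero ideal has finite
  codimension and contains a nonzero principal ideal, here the one generated by
  \<open>u\<close>.\<close>

definition ideal_dual :: "('f::field witt \<Rightarrow> 'f) set" where
  "ideal_dual = {f \<in> full_dual witt_scale. \<exists>u. u \<noteq> 0 \<and> (\<forall>v. f (u * v) = 0)}"

lemma ideal_dual_full_dual: "f \<in> ideal_dual \<Longrightarrow> f \<in> full_dual witt_scale"
  by (simp add: ideal_dual_def)

lemma subspace_ideal_dual: "fun_space.subspace ideal_dual"
proof (rule fun_space.subspaceI)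
  have "fun_space.subspace (full_dual witt_scale)"
    by (rule subspace_full_dual) (rule witt.vector_space_axioms)
  note closed = fun_space.subspace_0[OF this] fun_space.subspace_add[OF this]
    fun_space.subspace_scale[OF this]
  show "0 \<in> ideal_dual"
    using closed(1) by (auto simp: ideal_dual_def intro!: exI[of _ 1])
  show "fscale c f \<in> ideal_dual" if "f \<in> ideal_dual" for c f
    using that closed(3) by (auto simp: ideal_dual_def fscale_apply)
  show "f + g \<in> ideal_dual" if f: "f \<in> ideal_dual" and g: "g \<in> ideal_dual" for f g
  proof -
    obtain u w where u: "u \<noteq> 0" "\<forall>v. f (u * v) = 0" and w: "w \<noteq> 0" "\<forall>v. g (w * v) = 0"
      using f g by (auto simp: ideal_dual_def)
    \<comment> \<open>The product lies in both annihilating ideals, and it is nonzero because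
      Laurent polynomials have no zero divisors.\<close>
    have "(f + g) (u * w * v) = 0" for v
      using u(2)[rule_format, of "w * v"] w(2)[rule_format, of "u * v"]
      by (simp add: mult_ac)
    moreover have "u * w \<noteq> 0" using u w by simp
    ultimately show ?thesis
      using f g closed(2) by (auto simp: ideal_dual_def intro!: exI[of _ "u * w"])
  qed
qed

lemma ideal_dual_mult: "f \<in> ideal_dual \<Longrightarrow> (\<lambda>v. f (u * v)) \<in> ideal_dual"
  "f \<in> ideal_dual \<Longrightarrow> (\<lambda>v. f (v * u)) \<in> ideal_dual"
proof -
  assume f: "f \<in> ideal_dual"
  then obtain w where w: "w \<noteq> 0" "\<forall>v. f (w * v) = 0"
    by (auto simp: ideal_dual_def)
  have "f (u * (w * v)) = 0" for v
    using w(2)[rule_format, of "u * v"] by (simp add: mult_ac)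
  with w(1) f show *: "(\<lambda>v. f (u * v)) \<in> ideal_dual"
    by (auto simp: ideal_dual_def full_dual_mult intro!: exI[of _ w])
  then show "(\<lambda>v. f (v * u)) \<in> ideal_dual" by (simp add: mult.commute)
qed

lemma ideal_dual_deriv:
  assumes f: "f \<in> ideal_dual"
  shows "(\<lambda>v. f (laurent_deriv v)) \<in> ideal_dual"
proof -
  obtain w where w: "w \<noteq> 0" "\<forall>v. f (w * v) = 0"
    using f by (auto simp: ideal_dual_def)
  have "f (laurent_deriv (w * w * v)) = 0" for v
  proof -
    have "laurent_deriv (w * w * v) = w * (2 * laurent_deriv w * v + w * laurent_deriv v)"
      by (simp add: laurent_deriv_mult algebra_simps)
    then show ?thesis using w(2) by simp
  qed
  moreover have "w * w \<noteq> 0" using w by simp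
  ultimately show ?thesis
    using f full_dual_laurent_deriv unfolding ideal_dual_def by blast
qed

text \<open>The annihilator \<open>q\<close> is a recursion among the translates
  \<open>\<tau> i\<close>. Its extreme coefficients are nonzero, so it runs both upwards and
  downwards, and the translates in one window of length \<open>M - L\<close> span all of
  them.\<close>

lemma ideal_dual_translates:
  fixes f :: "'f::field witt \<Rightarrow> 'f"
  assumes f: "f \<in> ideal_dual"
  shows "\<exists>G. finite G \<and> G \<subseteq> ideal_dual \<and> (\<forall>u. (\<lambda>v. f (u * v)) \<in> fun_space.span G)"
proof -
  obtain q where q: "q \<noteq> 0" "\<forall>v. f (q * v) = 0"
    using f by (auto simp: ideal_dual_def)
  define \<tau> where "\<tau> = (\<lambda>i v. f (witt_x i * v))"
  define K where "K = Poly_Mapping.keys q"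
  have K: "finite K" "K \<noteq> {}" using q(1) by (auto simp: K_def)
  define L M where "L = Min K" and "M = Max K"
  have LM: "L \<in> K" "M \<in> K" "\<And>j. j \<in> K \<Longrightarrow> L \<le> j \<and> j \<le> M"
    using K by (auto simp: L_def M_def)
  define G where "G = \<tau> ` {L..<M}"
  let ?S = "fun_space.span G"
  have mul: "(\<lambda>v. f (u * v)) = (\<Sum>i\<in>Poly_Mapping.keys u. fscale (Poly_Mapping.lookup u i) (\<tau> i))" for u
    unfolding fun_sum_eq_fscale[symmetric] \<tau>_def
    by (rule ext)
      (rule full_dual_witt_expand[OF full_dual_mult(2)[OF ideal_dual_full_dual[OF f]] _ order_refl], simp)
  have rec: "(\<Sum>j\<in>K. fscale (Poly_Mapping.lookup q j) (\<tau> (j + m))) = 0" for m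
  proof
    fix v
    have "f (q * (witt_x m * v)) = (\<Sum>j\<in>K. fscale (Poly_Mapping.lookup q j) (\<tau> j)) (witt_x m * v)"
      using fun_cong[OF mul[of q], of "witt_x m * v"] by (simp add: K_def)
    also have "\<dots> = (\<Sum>j\<in>K. fscale (Poly_Mapping.lookup q j) (\<tau> (j + m))) v"
      by (simp add: sum_apply fscale_apply \<tau>_def mult.assoc[symmetric] witt_x_mult)
    finally show "(\<Sum>j\<in>K. fscale (Poly_Mapping.lookup q j) (\<tau> (j + m))) v = 0 v"
      using q(2) by simp
  qed
  \<comment> \<open>The recursion shifted by \<open>m\<close>, solved for the term with index
    \<open>j0\<close>.\<close>
  have solve: "\<tau> (j0 + m) \<in> ?S" if "j0 \<in> K" and other: "\<And>j. j \<in> K \<Longrightarrow> j \<noteq> j0 \<Longrightarrow> \<tau> (j + m) \<in> ?S" for j0 m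
  proof -
    define c where "c = Poly_Mapping.lookup q j0"
    have c: "c \<noteq> 0" using that(1) by (simp add: c_def K_def in_keys_iff)
    define R where "R = (\<Sum>j\<in>K - {j0}. fscale (Poly_Mapping.lookup q j) (\<tau> (j + m)))"
    have "R \<in> ?S" unfolding R_def
      by (intro fun_space.span_sum fun_space.span_scale other) auto
    moreover have "fscale c (\<tau> (j0 + m)) + R = 0"
      using rec[of m] that(1) K(1) by (simp add: R_def c_def sum.remove)
    then have "\<tau> (j0 + m) = fscale (- (1 / c)) R"
      using c by (simp add: fun_eq_iff fscale_apply field_simps add_eq_0_iff)
    ultimately show ?thesis by (simp only: fun_space.span_scale)
  qed
  \<comment> \<open>The known window grows by one exponent at each end: the top coefficient gives
    the new upper translate, the bottom one the new lower translate.\<close>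
  have all: "\<tau> i \<in> ?S" if "L - int n \<le> i" "i < M + int n" for i n
    using that
  proof (induction n arbitrary: i)
    case 0
    then show ?case by (intro fun_space.span_base) (auto simp: G_def)
  next
    case (Suc n)
    consider "L - int n \<le> i" "i < M + int n" | "i = M + int n" | "i = L - int n - 1"
      using Suc.prems by linarith
    then show ?case
    proof cases
      case 1
      then show ?thesis by (rule Suc.IH)
    next
      case 2
      have "\<tau> (M + int n) \<in> ?S"
        by (rule solve[OF LM(2)], rule Suc.IH) (use LM(3) in \<open>force+\<close>)
      then show ?thesis using 2 by simp
    next
      case 3
      have "\<tau> (L + (- int n - 1)) \<in> ?S"
        by (rule solve[OF LM(1)], rule Suc.IH) (use LM(3) in \<open>force+\<close>)
      moreover have "L + (- int n - 1) = i" using 3 by simp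
      ultimately show ?thesis by simp
    qed
  qed
  have "\<tau> i \<in> ?S" for i
    by (rule all[of "nat (\<bar>i\<bar> + \<bar>L\<bar> + \<bar>M\<bar> + 1)"]) auto
  then have "(\<lambda>v. f (u * v)) \<in> ?S" for u
    unfolding mul by (intro fun_space.span_sum fun_space.span_scale)
  moreover have "finite G" "G \<subseteq> ideal_dual"
    using ideal_dual_mult(1)[OF f] by (auto simp: G_def \<tau>_def)
  ultimately show ?thesis by blast
qed

text \<open>Interpolating \<open>f (u * v)\<close> as a function of \<open>v\<close> in the finite
  span of all translates separates the variables: the coefficients \<open>f (u * p i)\<close> depend
  on \<open>u\<close> only.\<close>

lemma ideal_dual_mult_form:
  assumes f: "f \<in> ideal_dual"
  shows "\<exists>(N::nat) a b. (\<forall>i<N. a i \<in> ideal_dual \<and> b i \<in> ideal_dual) \<and>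
    (\<forall>u v. f (u * v) = (\<Sum>i<N. a i u * b i v))"
proof -
  obtain G where G: "finite G" "G \<subseteq> ideal_dual" "\<And>u. (\<lambda>v. f (u * v)) \<in> fun_space.span G"
    using ideal_dual_translates[OF f] by blast
  obtain N :: nat and p \<phi> where \<phi>: "\<forall>i<N. \<phi> i \<in> fun_space.span G"
    "\<forall>g\<in>fun_space.span G. \<forall>x. g x = (\<Sum>i<N. g (p i) * \<phi> i x)"
    using finite_interpolation[OF G(1)] by blast
  have 1: "f (u * v) = (\<Sum>i<N. f (u * p i) * \<phi> i v)" for u v
    using \<phi>(2)[rule_format, OF G(3)[of u], of v] .
  have 2: "\<phi> i \<in> ideal_dual" if "i < N" for i
    using \<phi>(1) that fun_space.span_minimal[OF G(2) subspace_ideal_dual] by blast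
  show ?thesis
    by (intro exI[of _ N] exI[of _ "\<lambda>i u. f (u * p i)"] exI[of _ \<phi>] conjI allI impI)
      (rule 1 ideal_dual_mult(2)[OF f] 2, assumption?)+
qed

lemma good_subspace_ideal_dual: "good_subspace witt_scale witt_bracket ideal_dual"
proof -
  have "bracket_transpose witt_bracket f \<in> form_square ideal_dual" if f: "f \<in> ideal_dual"
    for f :: "'a witt \<Rightarrow> 'a"
  proof -
    obtain N :: nat and a b where ab: "\<forall>i<N. a i \<in> ideal_dual \<and> b i \<in> ideal_dual"
      "\<forall>u v. f (u * v) = (\<Sum>i<N. a i u * b i v)"
      using ideal_dual_mult_form[OF f] by blast
    \<comment> \<open>The bracket is \<open>u v' - u' v\<close>, so the decomposition of
      \<open>f (u * v)\<close> is used twice, with the derivative moved onto one factor.\<close>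
    have "bracket_transpose witt_bracket f = (\<lambda>u v. \<Sum>i<N. a i u * b i (laurent_deriv v))
        - (\<lambda>u v. \<Sum>i<N. a i (laurent_deriv u) * b i v)"
      by (simp add: fun_eq_iff bracket_transpose_def witt_bracket_def ab(2)[rule_format, symmetric]
          full_dual_witt_linear[OF ideal_dual_full_dual[OF f]])
    moreover have "(\<lambda>u v. \<Sum>i<N. a i u * b i (laurent_deriv v)) \<in> form_square ideal_dual"
      by (rule form_square_sum[of N a _ "\<lambda>i v. b i (laurent_deriv v)"])
        (use ab(1) ideal_dual_deriv in auto)
    moreover have "(\<lambda>u v. \<Sum>i<N. a i (laurent_deriv u) * b i v) \<in> form_square ideal_dual"
      by (rule form_square_sum[of N "\<lambda>i v. a i (laurent_deriv v)"])
        (use ab(1) ideal_dual_deriv in auto)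
    ultimately show ?thesis
      by (simp add: form_square_def form_space.span_diff)
  qed
  then show ?thesis
    using subspace_ideal_dual ideal_dual_full_dual unfolding good_subspace_def by blast
qed

text \<open>Used twice along \<open>fst\<close>: it lifts \<open>ideal_dual\<close> to the Virasoro
  algebra, and it lifts an arbitrary good subspace of the Witt algebra so that
  \<open>vir_good_subspace\<close> bounds it.\<close>

lemma good_subspace_pullback:
  assumes V: "good_subspace s br V" and s: "vector_space s" "vector_space s'"
    and \<pi>: "\<And>a b. \<pi> (a + b) = \<pi> a + \<pi> b" "\<And>t a. \<pi> (s' t a) = s t (\<pi> a)"
      "\<And>a b. \<pi> (br' a b) = br (\<pi> a) (\<pi> b)"
  shows "good_subspace s' br' ((\<lambda>g u. g (\<pi> u)) ` V)"
proof -
  let ?W = "(\<lambda>g u. g (\<pi> u)) ` V"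
  have sub: "fun_space.subspace V" using V by (simp add: good_subspace_def)
  have "?W \<subseteq> full_dual s'"
    using V by (auto simp: good_subspace_def full_dual_iff[OF s(1)] full_dual_iff[OF s(2)] \<pi>)
  moreover have "fun_space.subspace ?W"
  proof (rule fun_space.subspaceI)
    show "0 \<in> ?W"
      by (rule image_eqI[of _ _ 0]) (use fun_space.subspace_0[OF sub] in \<open>auto simp: fun_eq_iff\<close>)
  next
    fix x y c assume "x \<in> ?W" "y \<in> ?W"
    then obtain x' y' where xy: "x' \<in> V" "x = (\<lambda>u. x' (\<pi> u))" "y' \<in> V" "y = (\<lambda>u. y' (\<pi> u))"
      by blast
    show "x + y \<in> ?W"
      by (rule image_eqI[of _ _ "x' + y'"])
        (use xy fun_space.subspace_add[OF sub] in \<open>auto simp: fun_eq_iff\<close>)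
    show "fscale c x \<in> ?W"
      by (rule image_eqI[of _ _ "fscale c x'"])
        (use xy fun_space.subspace_scale[OF sub] in \<open>auto simp: fun_eq_iff fscale_apply\<close>)
  qed
  moreover have "bracket_transpose br' h \<in> form_square ?W" if "h \<in> ?W" for h
  proof -
    obtain g where g: "g \<in> V" "h = (\<lambda>u. g (\<pi> u))" using \<open>h \<in> ?W\<close> by blast
    then have "bracket_transpose br g \<in> form_square V" using V by (simp add: good_subspace_def)
    then obtain N :: nat and a b where ab: "\<forall>i<N. a i \<in> V \<and> b i \<in> V"
      "bracket_transpose br g = (\<lambda>u v. \<Sum>i<N. a i u * b i v)"
      using form_square_rep[OF sub] by blast
    have "bracket_transpose br' h = (\<lambda>u v. bracket_transpose br g (\<pi> u) (\<pi> v))"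
      by (simp add: g bracket_transpose_def \<pi>)
    also have "\<dots> = (\<lambda>u v. \<Sum>i<N. a i (\<pi> u) * b i (\<pi> v))"
      by (simp add: ab(2))
    also have "\<dots> \<in> form_square ?W"
      by (rule form_square_sum[of N "\<lambda>i u. a i (\<pi> u)" _ "\<lambda>i u. b i (\<pi> u)"]) (use ab(1) in auto)
    finally show ?thesis .
  qed
  ultimately show ?thesis by (simp add: good_subspace_def)
qed

section \<open>Functionals whose bracket form has finite rank\<close>

lemma common_kernel_vector:
  fixes \<F> :: "('f::field witt \<Rightarrow> 'f) set"
  assumes "finite \<F>" "\<F> \<subseteq> full_dual witt_scale"
  shows "\<exists>u j. j \<noteq> 0 \<and> Poly_Mapping.lookup u j \<noteq> 0 \<and> (\<forall>F\<in>\<F>. F u = 0)"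
proof -
  define G where "G = (\<lambda>F i. F (witt_x i)) ` \<F>"
  have "finite G" using assms(1) by (simp add: G_def)
  from finite_interpolation[OF this] obtain N :: nat and p \<phi> where
    \<phi>: "\<forall>g\<in>fun_space.span G. \<forall>x. g x = (\<Sum>i<N. g (p i) * \<phi> i x)"
    by blast
  have "finite (insert 0 (p ` {..<N}))" by simp
  \<comment> \<open>Any exponent off the nodes would give a nonzero kernel vector. Excluding 0
    matters in \<open>vir_finite_rank\<close>, where the second difference is a multiple of
    \<open>j\<close>.\<close>
  then obtain j where j: "j \<notin> insert 0 (p ` {..<N})"
    using ex_new_if_finite[OF infinite_UNIV_int] by blast
  \<comment> \<open>Interpolation at the nodes predicts the value of each functional at
    \<open>x\<^sup>j\<close>; subtracting the prediction leaves a vector that all of them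
    kill.\<close>
  define u where "u = witt_x j - (\<Sum>i<N. witt_scale (\<phi> i j) (witt_x (p i)))"
  have "(\<Sum>i<N. Poly_Mapping.lookup (witt_scale (\<phi> i j) (witt_x (p i))) j) = 0"
    by (rule sum.neutral) (use j in \<open>auto simp: lookup_witt_scale witt_x_def lookup_single when_def\<close>)
  then have "Poly_Mapping.lookup u j = 1"
    by (simp add: u_def lookup_minus lookup_sum witt_x_def)
  moreover have "F u = 0" if "F \<in> \<F>" for F
  proof -
    have "F \<in> full_dual witt_scale" using that assms(2) by blast
    note lin = full_dual_witt_linear[OF this]
    have "(\<lambda>i. F (witt_x i)) \<in> fun_space.span G"
      by (rule fun_space.span_base) (use that in \<open>auto simp: G_def\<close>)
    from \<phi>[rule_format, OF this, of j]
    have "F (witt_x j) = (\<Sum>i<N. F (witt_x (p i)) * \<phi> i j)" .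
    then show ?thesis by (simp add: u_def lin mult.commute)
  qed
  ultimately show ?thesis using j by (intro exI[of _ u] exI[of _ j]) auto
qed

lemma laurent_deriv_witt_x_1: "laurent_deriv (witt_x 1) = 1"
  by (simp add: witt_x_def laurent_deriv_single)

text \<open>As \<open>x\<close> has derivative 1, each of the two brackets contributes one extra
  \<open>u v\<close> by the product rule, and everything else cancels.\<close>

lemma witt_bracket_shift:
  "witt_bracket u (witt_x 1 * v) - witt_bracket (witt_x 1 * u) v = 2 * (u * v)"
  by (simp add: witt_bracket_def laurent_deriv_mult laurent_deriv_witt_x_1 algebra_simps)

lemma vir_cocycle_witt_x:
  "vir_cocycle p (witt_x m)
    = Poly_Mapping.lookup p (2 - m) * (of_int ((1 - m) ^ 3 - (1 - m)) / 12)"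
proof -
  have "vir_cocycle p (witt_x m) = (\<Sum>i\<in>Poly_Mapping.keys p. if i = 2 - m
      then Poly_Mapping.lookup p i * (of_int ((i - 1) ^ 3 - (i - 1)) / 12) else 0)"
    unfolding vir_cocycle_def
    by (intro sum.cong refl) (auto simp: witt_x_def lookup_single when_def)
  then show ?thesis by (auto simp: sum.delta in_keys_iff)
qed

text \<open>
  With \<open>u\<close>, \<open>x u\<close> and \<open>x\<^sup>2 u\<close> in the kernel, applying \<open>witt_bracket_shift\<close> twice cancels the Witt
  part and leaves a second difference of the cocycle, which forces \<open>f c = 0\<close>.
\<close>

lemma vir_finite_rank:
  fixes f :: "'f::field_char_0 virasoro \<Rightarrow> 'f"
  assumes f: "f \<in> full_dual vir_scale" and a: "\<forall>i<N. a i \<in> full_dual vir_scale"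
    and rank: "\<And>u v. f (vir_bracket u v) = (\<Sum>i<(N::nat). a i u * b i v)"
  shows "\<exists>g\<in>ideal_dual. f = (\<lambda>u. g (fst u))"
proof -
  \<comment> \<open>Composing \<open>a i\<close> with multiplication by 1, \<open>x\<close> and
    \<open>x\<^sup>2\<close> puts \<open>u\<close>, \<open>x u\<close> and
    \<open>x\<^sup>2 u\<close> into the left kernel of the form simultaneously.\<close>
  define \<F> where "\<F> = (\<lambda>(i, t) w. a i (witt_x t * w, 0)) ` ({..<N} \<times> {0, 1, 2})"
  have "(\<lambda>w. a i (witt_x t * w, 0)) \<in> full_dual witt_scale" if "i < N" for i t
  proof -
    have ai: "a i \<in> full_dual vir_scale" using a that by blast
    have "a i (p + q, 0) = a i (p, 0) + a i (q, 0)" "a i (witt_scale c p, 0) = c * a i (p, 0)" for p q c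
      using full_dual_vir_linear(1)[OF ai, of "(p, 0)" "(q, 0)"]
        full_dual_vir_linear(2)[OF ai, of c "(p, 0)"] by (simp_all add: vir_scale_def)
    then show ?thesis
      by (simp add: full_dual_witt distrib_left witt_scale_mult_right[symmetric])
  qed
  then have "finite \<F>" "\<F> \<subseteq> full_dual witt_scale" by (auto simp: \<F>_def)
  from common_kernel_vector[OF this] obtain u j where
    j: "j \<noteq> 0" "Poly_Mapping.lookup u j \<noteq> 0" and u: "\<forall>F\<in>\<F>. F u = 0" by blast
  define g where "g = (\<lambda>p. f (p, 0))"
  define \<gamma> where "\<gamma> = f (0, 1)"
  have f_eq: "f (p, z) = g p + z * \<gamma>" for p z
    using full_dual_vir_linear(1)[OF f, of "(p, 0)" "(0, z)"]
      full_dual_vir_linear(2)[OF f, of z "(0, 1)"]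
    by (simp add: g_def \<gamma>_def vir_scale_def)
  have g: "g \<in> full_dual witt_scale"
    using full_dual_vir_linear(1)[OF f, of "(_, 0)" "(_, 0)"]
      full_dual_vir_linear(2)[OF f, of _ "(_, 0)"]
    by (simp add: full_dual_witt g_def vir_scale_def)
  note g_lin = full_dual_witt_linear[OF g]
  have ker: "g (witt_bracket (witt_x t * u) v) + vir_cocycle (witt_x t * u) v * \<gamma> = 0"
    if "t \<in> {0, 1, 2}" for t v
  proof -
    have "a i (witt_x t * u, 0) = 0" if "i < N" for i
      using u \<open>t \<in> {0, 1, 2}\<close> that by (force simp: \<F>_def)
    then have "f (vir_bracket (witt_x t * u, 0) (v, 0)) = 0" by (simp add: rank)
    then show ?thesis by (simp add: vir_bracket_def f_eq)
  qed
  let ?x = "witt_x 1 :: 'f witt"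
  have x0: "witt_x 0 = (1 :: 'f witt)" by (simp add: witt_x_def)
  have x2: "witt_x 2 * p = ?x * (?x * p)" for p :: "'f witt"
    by (simp add: mult.assoc[symmetric] witt_x_mult)
  have "\<gamma> = 0"
  proof -
    \<comment> \<open>With this exponent all three cocycle values pick out the same coefficient of
      \<open>u\<close>, the nonzero one at \<open>j\<close>.\<close>
    define v where "v = (witt_x (- j) :: 'f witt)"
    let ?\<omega> = "\<lambda>p q. vir_cocycle p q * \<gamma>"
    have "witt_bracket u (?x * (?x * v)) - witt_bracket (?x * u) (?x * v)
      = witt_bracket (?x * u) (?x * v) - witt_bracket (?x * (?x * u)) v"
      unfolding witt_bracket_shift by (simp add: mult_ac)
    from arg_cong[OF this, of g, unfolded g_lin(4)] ker[of 0 "?x * (?x * v)", unfolded x0]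
      ker[of 1 "?x * v"] ker[of 2 v, unfolded x2]
    have d: "?\<omega> u (?x * (?x * v)) - 2 * ?\<omega> (?x * u) (?x * v) + ?\<omega> (?x * (?x * u)) v = 0"
      by (simp only: mult_1 insert_iff simp_thms) algebra
    have c:
      "vir_cocycle u (?x * (?x * v)) = Poly_Mapping.lookup u j * (((of_int j - 1) ^ 3 - (of_int j - 1)) / 12)"
      "vir_cocycle (?x * u) (?x * v) = Poly_Mapping.lookup u j * ((of_int j ^ 3 - of_int j) / 12)"
      "vir_cocycle (?x * (?x * u)) v = Poly_Mapping.lookup u j * (((of_int j + 1) ^ 3 - (of_int j + 1)) / 12)"
      by (simp add: v_def witt_x_mult vir_cocycle_witt_x lookup_witt_x_mult;
          simp add: algebra_simps)+
    \<comment> \<open>The second difference of \<open>(J\<^sup>3 - J) / 12\<close> is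
      \<open>J / 2\<close>.\<close>
    have "L * (((J - 1) ^ 3 - (J - 1)) / 12) * \<gamma> - 2 * (L * ((J ^ 3 - J) / 12) * \<gamma>)
      + L * (((J + 1) ^ 3 - (J + 1)) / 12) * \<gamma> = \<gamma> * L * J / 2" for L J
      by (simp add: power3_eq_cube field_simps)
    from d[unfolded c this] show ?thesis using j by simp
  qed
  have "g (u * v) = 0" for v
  proof -
    have "g (witt_bracket u (?x * v) - witt_bracket (?x * u) v) = 0"
      using ker[of 0 "?x * v"] ker[of 1 v] by (simp add: g_lin x0 \<open>\<gamma> = 0\<close>)
    then have "g (u * v) + g (u * v) = 0"
      unfolding witt_bracket_shift mult_2 g_lin(1) .
    then show ?thesis by simp
  qed
  moreover have "u \<noteq> 0" using j by auto
  ultimately have "g \<in> ideal_dual" using g by (auto simp: ideal_dual_def)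
  moreover have "f = (\<lambda>w. g (fst w))"
    using f_eq \<open>\<gamma> = 0\<close> by (auto simp: fun_eq_iff)
  ultimately show ?thesis by blast
qed

lemma vir_good_subspace:
  fixes V :: "('f::field_char_0 virasoro \<Rightarrow> 'f) set"
  assumes V: "good_subspace vir_scale vir_bracket V"
  shows "V \<subseteq> (\<lambda>g u. g (fst u)) ` ideal_dual"
proof
  fix f assume f: "f \<in> V"
  have "bracket_transpose vir_bracket f \<in> form_square V"
    using V f by (simp add: good_subspace_def)
  then obtain N :: nat and a b where ab: "\<forall>i<N. a i \<in> V \<and> b i \<in> V"
    "bracket_transpose vir_bracket f = (\<lambda>u v. \<Sum>i<N. a i u * b i v)"
    using form_square_rep V unfolding good_subspace_def by blast
  have "f (vir_bracket u v) = (\<Sum>i<N. a i u * b i v)" for u v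
    using fun_cong[OF fun_cong[OF ab(2), of u], of v] by (simp add: bracket_transpose_def)
  then show "f \<in> (\<lambda>g u. g (fst u)) ` ideal_dual"
    using vir_finite_rank[of f N a b] V f ab(1) unfolding good_subspace_def by blast
qed

lemma lie_dual_vir:
  "lie_dual (vir_scale :: 'f::field_char_0 \<Rightarrow> _) vir_bracket = (\<lambda>g u. g (fst u)) ` ideal_dual"
  by (rule lie_dual_eqI[OF good_subspace_pullback[OF good_subspace_ideal_dual
        witt.vector_space_axioms vir.vector_space_axioms]])
    (simp_all add: vir_scale_def vir_bracket_def vir_good_subspace)

text \<open>Maximality is inherited from the Virasoro case: \<open>fst\<close> is surjective, so a
  functional is recovered from its pullback.\<close>

lemma lie_dual_witt: "lie_dual (witt_scale :: 'f::field_char_0 \<Rightarrow> _) witt_bracket = ideal_dual"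
proof (rule lie_dual_eqI[OF good_subspace_ideal_dual])
  fix V :: "('f witt \<Rightarrow> 'f) set"
  assume "good_subspace witt_scale witt_bracket V"
  then have "good_subspace vir_scale vir_bracket ((\<lambda>g u. g (fst u)) ` V)"
    by (rule good_subspace_pullback[OF _ witt.vector_space_axioms vir.vector_space_axioms])
      (simp_all add: vir_scale_def vir_bracket_def)
  then have *: "(\<lambda>g u. g (fst u)) ` V \<subseteq> (\<lambda>g (u :: 'f virasoro). g (fst u)) ` ideal_dual"
    by (rule vir_good_subspace)
  show "V \<subseteq> ideal_dual"
  proof
    fix f assume "f \<in> V"
    then obtain g where g: "g \<in> ideal_dual"
      "(\<lambda>u :: 'f virasoro. f (fst u)) = (\<lambda>u. g (fst u))" using * by blast
    have "f p = g p" for p using fun_cong[OF g(2), of "(p, 0)"] by simp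
    then have "f = g" by (rule ext)
    then show "f \<in> ideal_dual" using g by simp
  qed
qed

section \<open>Infinite sums of dual elements and linear recursions\<close>

lemma eps_sum_witt:
  assumes "finite A" "Poly_Mapping.keys p \<subseteq> A"
  shows "eps_sum witt_eps a p = (\<Sum>i\<in>A. a i * Poly_Mapping.lookup p i)"
  unfolding eps_sum_def witt_eps_def
  by (rule Sum_any.expand_superset) (use assms in \<open>auto simp: in_keys_iff\<close>)

lemma eps_sum_witt_x: "eps_sum witt_eps a (witt_x i) = a i"
  by (subst eps_sum_witt[of "{i}"]) (auto simp: witt_x_def)

lemma eps_sum_full_dual: "eps_sum witt_eps a \<in> full_dual witt_scale"
proof -
  have "eps_sum witt_eps a (p + q) = eps_sum witt_eps a p + eps_sum witt_eps a q" for p q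
  proof -
    let ?A = "Poly_Mapping.keys p \<union> Poly_Mapping.keys q"
    show ?thesis
      using Poly_Mapping.keys_add[of p q]
      by (simp add: eps_sum_witt[of ?A] lookup_add distrib_left sum.distrib)
  qed
  moreover have "eps_sum witt_eps a (witt_scale t p) = t * eps_sum witt_eps a p" for t p
  proof -
    have "Poly_Mapping.keys (witt_scale t p) \<subseteq> Poly_Mapping.keys p"
      by (auto simp: in_keys_iff lookup_witt_scale)
    then show ?thesis
      by (simp add: eps_sum_witt[of "Poly_Mapping.keys p"] lookup_witt_scale sum_distrib_left mult_ac)
  qed
  ultimately show ?thesis by (simp add: full_dual_witt)
qed

lemma full_dual_eps_sum:
  "f \<in> full_dual witt_scale \<Longrightarrow> f = eps_sum witt_eps (\<lambda>i. f (witt_x i))"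
  by (rule ext, subst eps_sum_witt[OF _ order_refl])
    (simp_all add: full_dual_witt_expand[OF _ _ order_refl] mult.commute)

text \<open>A recursion with coefficients \<open>h\<close> says exactly that the functional vanishes
  on the ideal of its characteristic element. Conversely, an annihilator becomes a recursion after
  division by its top coefficient.\<close>

lemma linearly_recursive_iff:
  "linearly_recursive a \<longleftrightarrow> eps_sum witt_eps a \<in> (ideal_dual :: ('f::field witt \<Rightarrow> 'f) set)"
proof
  let ?f = "eps_sum witt_eps a :: 'f witt \<Rightarrow> 'f"
  note lin = full_dual_witt_linear[OF eps_sum_full_dual]
  assume "linearly_recursive a"
  then obtain r :: nat and h where rec: "\<And>m. a m = (\<Sum>i=1..r. h i * a (m - int i))"
    unfolding linearly_recursive_def by blast
  \<comment> \<open>The characteristic element of the recursion: evaluating at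
    \<open>u * witt_x m\<close> gives \<open>a m\<close> minus the right-hand side of the
    recursion.\<close>
  define u where "u = witt_x 0 - (\<Sum>i=1..r. witt_scale (h i) (witt_x (- int i)))"
  have "(\<Sum>i=1..r. Poly_Mapping.lookup (witt_scale (h i) (witt_x (- int i))) 0) = 0"
    by (rule sum.neutral) (auto simp: lookup_witt_scale witt_x_def lookup_single when_def)
  then have "Poly_Mapping.lookup u 0 = 1"
    by (simp add: u_def lookup_minus lookup_sum witt_x_def del: single_one)
  then have "u \<noteq> 0" by auto
  moreover have "?f (u * witt_x m) = 0" for m
    by (simp add: u_def left_diff_distrib sum_distrib_right lin witt_scale_mult_left[symmetric]
        witt_x_mult eps_sum_witt_x rec[of m])
  then have "?f (u * v) = 0" for v
    by (subst full_dual_witt_expand[OF full_dual_mult(1)[OF eps_sum_full_dual] finite_keys order_refl])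
      simp
  ultimately show "?f \<in> ideal_dual" by (auto simp: ideal_dual_def eps_sum_full_dual)
next
  let ?f = "eps_sum witt_eps a :: 'f witt \<Rightarrow> 'f"
  assume "?f \<in> ideal_dual"
  then obtain u :: "'f witt" where u: "u \<noteq> 0" "\<And>v. ?f (u * v) = 0" by (auto simp: ideal_dual_def)
  define K where "K = Poly_Mapping.keys u"
  have K: "finite K" "K \<noteq> {}" using u(1) by (auto simp: K_def)
  define L M where "L = Min K" and "M = Max K"
  \<comment> \<open>The added 1 keeps \<open>r \<ge> 1\<close> when \<open>u\<close> is a monomial;
    surplus coefficients are 0.\<close>
  define r where "r = nat (M - L) + 1"
  define c where "c = Poly_Mapping.lookup u M"
  have c: "c \<noteq> 0" using Max_in[OF K] by (simp add: c_def K_def M_def in_keys_iff)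
  have sub: "K \<subseteq> (\<lambda>i. M - int i) ` {0..r}"
  proof
    fix j assume "j \<in> K"
    then have "L \<le> j" "j \<le> M" using K by (auto simp: L_def M_def)
    then show "j \<in> (\<lambda>i. M - int i) ` {0..r}"
      by (intro image_eqI[of _ _ "nat (M - j)"]) (auto simp: r_def)
  qed
  have rec: "a m = (\<Sum>i=1..r. (- Poly_Mapping.lookup u (M - int i) / c) * a (m - int i))" for m
  proof -
    have "0 = ?f (u * witt_x (m - M))" by (simp add: u(2))
    also have "\<dots> = (\<Sum>j\<in>(\<lambda>i. M - int i) ` {0..r}. Poly_Mapping.lookup u j * a (j + (m - M)))"
      by (subst full_dual_witt_expand[OF full_dual_mult(2)[OF eps_sum_full_dual] _ sub[unfolded K_def]])
        (simp_all add: witt_x_mult eps_sum_witt_x)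
    also have "\<dots> = (\<Sum>i=0..r. Poly_Mapping.lookup u (M - int i) * a (m - int i))"
      by (subst sum.reindex) (auto simp: inj_on_def algebra_simps)
    also have "\<dots> = c * a m + (\<Sum>i=1..r. Poly_Mapping.lookup u (M - int i) * a (m - int i))"
      by (simp add: sum.atLeast_Suc_atMost c_def)
    finally have "a m = - (\<Sum>i=1..r. Poly_Mapping.lookup u (M - int i) * a (m - int i)) / c"
      using c by (simp add: field_simps add_eq_0_iff)
    then show ?thesis by (simp add: sum_negf sum_divide_distrib)
  qed
  show "linearly_recursive a"
    unfolding linearly_recursive_def
    by (intro exI[of _ r] exI[of _ "\<lambda>i. - Poly_Mapping.lookup u (M - int i) / c"] conjI allI)
      (simp add: r_def, rule rec)
qed

lemma ideal_dual_eq: "ideal_dual = {eps_sum witt_eps a | a. linearly_recursive a}"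
proof -
  have "f \<in> {eps_sum witt_eps a | a. linearly_recursive a}" if "f \<in> ideal_dual" for f :: "'a witt \<Rightarrow> 'a"
    using that full_dual_eps_sum[OF ideal_dual_full_dual[OF that]]
    by (auto simp: linearly_recursive_iff)
  then show ?thesis by (auto simp: linearly_recursive_iff)
qed

lemma eps_sum_vir: "eps_sum vir_eps a = (\<lambda>u. eps_sum witt_eps a (fst u))"
  by (simp add: eps_sum_def vir_eps_def)

section \<open>Structure constants of the dual\<close>

lemma witt_eps_full_dual: "witt_eps i \<in> full_dual witt_scale"
  by (simp add: full_dual_witt witt_eps_def lookup_add lookup_witt_scale)

lemma lookup_witt_bracket_x:
  "Poly_Mapping.lookup (witt_bracket p (witt_x t)) i
    = of_int (2 * t - 1 - i) * Poly_Mapping.lookup p (i + 1 - t)"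
proof (induction p rule: single_add_induct)
  case (single j c)
  show ?case
    by (cases "j = i + 1 - t") (auto simp: witt_x_def witt_bracket_single lookup_single when_def)
qed (simp add: witt_bracket_add lookup_add distrib_left)

lemma eps_cobracket_witt: "eps_cobracket witt_eps m p q = Poly_Mapping.lookup (witt_bracket p q) m"
proof -
  let ?K = "Poly_Mapping.keys p" and ?L = "Poly_Mapping.keys q"
  have "eps_cobracket witt_eps m p q = (\<Sum>(i, j)\<in>?K \<times> ?L. if i + j = m + 1
      then of_int (j - i) * (witt_eps i p * witt_eps j q) else 0)"
    unfolding eps_cobracket_def
    by (rule Sum_any.expand_superset) (auto simp: witt_eps_def in_keys_iff split: if_splits)
  also have "\<dots> = (\<Sum>j\<in>?L. \<Sum>i\<in>?K. if i = m + 1 - j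
      then of_int (j - i) * (witt_eps i p * witt_eps j q) else 0)"
    unfolding sum.cartesian_product[symmetric]
    by (subst sum.swap) (intro sum.cong refl if_cong, auto)
  \<comment> \<open>Substituting \<open>i = m + 1 - j\<close> turns the weight \<open>j - i\<close>
    into \<open>2 j - 1 - m\<close>, the coefficient in
    \<open>lookup_witt_bracket_x\<close>.\<close>
  also have "\<dots> = (\<Sum>j\<in>?L. Poly_Mapping.lookup q j *
      (of_int (2 * j - 1 - m) * Poly_Mapping.lookup p (m + 1 - j)))"
    by (intro sum.cong refl, subst sum.delta) (auto simp: witt_eps_def in_keys_iff algebra_simps)
  also have "\<dots> = Poly_Mapping.lookup (witt_bracket p q) m"
  proof -
    have "(\<lambda>q. Poly_Mapping.lookup (witt_bracket p q) m) \<in> full_dual witt_scale"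
      by (simp add: full_dual_witt witt_bracket_add witt_bracket_scale lookup_add lookup_witt_scale)
    from full_dual_witt_expand[OF this finite_keys order_refl, of q]
    show ?thesis by (simp add: lookup_witt_bracket_x)
  qed
  finally show ?thesis .
qed

lemma eps_cobracket_pullback:
  "eps_cobracket (\<lambda>i u. witt_eps i (\<pi> u)) m u v
    = Poly_Mapping.lookup (witt_bracket (\<pi> u) (\<pi> v)) m"
  unfolding eps_cobracket_witt[symmetric] by (simp add: eps_cobracket_def)

lemma eps_sum_pullback:
  "eps_sum (\<lambda>i u. witt_eps i (\<pi> u)) a = (\<lambda>u. eps_sum witt_eps a (\<pi> u))"
  by (simp add: eps_sum_def)

text \<open>
  The projection \<open>\<pi>\<close> is the identity for the Witt algebra and \<open>fst\<close> for the Virasoro algebra.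
\<close>

lemma cobracket_description_pullback:
  assumes lie: "lie_algebra s UNIV br" and \<pi>: "\<And>u v. \<pi> (br u v) = witt_bracket (\<pi> u) (\<pi> v)"
    and dual: "lie_dual s br = (\<lambda>g u. g (\<pi> u)) ` ideal_dual"
  shows "cobracket_description s br (\<lambda>i u. witt_eps i (\<pi> u))"
proof -
  interpret lie_alg s br by unfold_locales (rule lie)
  have "finite {(i, j). i + j = m + 1 \<and> witt_eps i (\<pi> u) * witt_eps j (\<pi> v) \<noteq> 0}" for m u v
    by (rule finite_subset[of _ "Poly_Mapping.keys (\<pi> u) \<times> Poly_Mapping.keys (\<pi> v)"])
      (auto simp: witt_eps_def in_keys_iff)
  moreover have "finite {m. eps_cobracket (\<lambda>i u. witt_eps i (\<pi> u)) m u v \<noteq> 0}" for u v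
    by (simp add: eps_cobracket_pullback)
  moreover have "tensor_to_form (dual_cobracket s br (eps_sum (\<lambda>i u. witt_eps i (\<pi> u)) a)) =
      (\<lambda>u v. Sum_any (\<lambda>m. a m * eps_cobracket (\<lambda>i u. witt_eps i (\<pi> u)) m u v))"
    if "linearly_recursive a" for a
  proof -
    have "eps_sum (\<lambda>i u. witt_eps i (\<pi> u)) a \<in> V"
      using that unfolding dual eps_sum_pullback[of \<pi>] by (auto simp: linearly_recursive_iff)
    from cobr_form[OF this] show ?thesis
      by (simp add: bracket_transpose_def eps_cobracket_pullback \<pi>)
        (simp add: eps_sum_def witt_eps_def \<pi>)
  qed
  moreover have "bracket_transpose br (\<lambda>u. witt_eps m (\<pi> u))
      = eps_cobracket (\<lambda>i u. witt_eps i (\<pi> u)) m" for m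
    by (simp add: fun_eq_iff bracket_transpose_def eps_cobracket_pullback \<pi>)
      (simp add: witt_eps_def)
  ultimately show ?thesis by (simp add: cobracket_description_def)
qed

text \<open>The dual bracket written out without tensors on Witt functionals. The projection of the
  Virasoro algebra is a homomorphism preserving \<open>X\<close> and \<open>Y\<close>, so the same
  formula describes pulled back functionals there.\<close>

definition witt_dual_bracket ::
  "int \<Rightarrow> 'f::field \<Rightarrow> 'f \<Rightarrow> ('f witt \<Rightarrow> 'f) \<Rightarrow> ('f witt \<Rightarrow> 'f) \<Rightarrow> 'f witt \<Rightarrow> 'f" where
  "witt_dual_bracket n l k f g p =
     (let X = elem_X witt_scale witt_x n l; Y = elem_Y witt_scale witt_x n l k in
       f (witt_bracket p X) * g Y + f X * g (witt_bracket p Y)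
         - f (witt_bracket p Y) * g X - f Y * g (witt_bracket p X))"

lemma witt_eps_X:
  "n \<noteq> 1 \<Longrightarrow> witt_eps i (elem_X witt_scale witt_x n l)
    = (if i = 1 then - 1 / (of_int n - 1) else if i = n then l else 0)"
  by (auto simp: witt_eps_def elem_X_def lookup_add lookup_minus lookup_witt_scale witt_x_def lookup_single
      when_def)

text \<open>For \<open>n \<noteq> 1\<close> the exponents 1, \<open>n\<close> and
  \<open>2 - n\<close> are pairwise distinct, so the three coefficients never merge.\<close>

lemma witt_eps_Y:
  "n \<noteq> 1 \<Longrightarrow> witt_eps i (elem_Y witt_scale witt_x n l k)
    = (if i = 1 then k else if i = n then - ((of_int n - 1) * l * k / 2)
       else if i = 2 - n then - (k / (2 * (of_int n - 1) * l)) else 0)"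
  by (auto simp: witt_eps_def elem_Y_def lookup_add lookup_minus lookup_witt_scale witt_x_def lookup_single
      when_def)

lemma witt_eps_bracket_X:
  "witt_eps i (witt_bracket p (elem_X witt_scale witt_x n l))
    = - (1 / (of_int n - 1)) * of_int (1 - i) * witt_eps i p
      + l * of_int (2 * n - 1 - i) * witt_eps (i - n + 1) p"
proof -
  have "i + 1 - n = i - n + 1" "2 * 1 - 1 - i = 1 - i" "i + 1 - 1 = i" by auto
  then show ?thesis
    by (simp only: elem_X_def witt_eps_def witt_bracket_add witt_bracket_scale lookup_add
      lookup_witt_scale lookup_witt_bracket_x) (simp add: mult.assoc)
qed

lemma witt_eps_bracket_Y:
  "witt_eps i (witt_bracket p (elem_Y witt_scale witt_x n l k))
    = - (k / (2 * (of_int n - 1) * l)) * of_int (3 - 2 * n - i) * witt_eps (i + n - 1) p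
      + k * of_int (1 - i) * witt_eps i p
      - ((of_int n - 1) * l * k / 2) * of_int (2 * n - 1 - i) * witt_eps (i - n + 1) p"
proof -
  have "2 * (2 - n) - 1 - i = 3 - 2 * n - i" "i + 1 - (2 - n) = i + n - 1"
    "i + 1 - n = i - n + 1" "- n + 2 = 2 - n" "2 * 1 - 1 - i = 1 - i" "i + 1 - 1 = i" by auto
  then show ?thesis
    by (simp only: elem_Y_def witt_eps_def witt_bracket_add witt_bracket_scale lookup_add
      lookup_witt_scale lookup_witt_bracket_x) (simp add: mult.assoc)
qed

lemma eps_bracket_table_witt:
  fixes l k :: "'f::field_char_0"
  assumes n: "n \<noteq> 1" and l: "l \<noteq> 0"
  shows "eps_bracket_table witt_eps n l k (\<lambda>i j. witt_dual_bracket n l k (witt_eps i) (witt_eps j))"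
proof -
  \<comment> \<open>All denominators become products of the nonzero quantities \<open>N\<close>,
    \<open>l\<close> and numerals.\<close>
  define N :: 'f where "N = of_int n - 1"
  have nN: "of_int n = N + 1" by (simp add: N_def)
  have N0: "N \<noteq> 0" using n by (metis N_def eq_iff_diff_eq_0 of_int_1 of_int_eq_iff)
  have ne: "n \<noteq> 2 - n" "2 - n \<noteq> n" "2 - n \<noteq> 1" using n by auto
  note val = witt_eps_X[OF n] witt_eps_Y[OF n] witt_eps_bracket_X witt_eps_bracket_Y
  let ?E = "\<lambda>i j. witt_dual_bracket n l k (witt_eps i) (witt_eps j)"
  have 0: "?E i j = - ?E j i" for i j
    by (simp add: fun_eq_iff witt_dual_bracket_def Let_def)
  have 1: "?E 1 j = fscale (- k * (of_bool (j = n) + of_bool (j = 2 - n))) (witt_eps j)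
          - fscale (k * of_int (j + 2 * n - 3) / (2 * (of_int n - 1) ^ 2 * l)) (witt_eps (j + n - 1))
          - fscale (k * l / 2 * of_int (2 * n - j - 1)) (witt_eps (j - n + 1))" if "j \<noteq> 1" for j
  proof -
    \<comment> \<open>The values of \<open>witt_eps j\<close> at \<open>X\<close> and
      \<open>Y\<close> change at these exponents; they account for the Kronecker deltas in the
      table.\<close>
    consider "j = n" | "j = 2 - n" | "j \<notin> {n, 2 - n}" by blast
    then show ?thesis
      by cases (use that n l N0 ne in \<open>simp_all add: fun_eq_iff witt_dual_bracket_def Let_def val
          fscale_apply nN\<close>, (simp add: field_simps power2_eq_square)+)
  qed
  have 2: "?E (2 - n) j = - fscale (k / 2 * of_bool (j = n)) (witt_eps 1)
          - fscale (k * l / 2 * (of_int n - 1) * of_bool (j = n)) (witt_eps (2 - n))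
          + fscale (k * of_int (j - 1) / (2 * (of_int n - 1) ^ 2 * l)) (witt_eps j)
          + fscale (k * of_int (2 * n - j - 1) / (2 * (of_int n - 1))) (witt_eps (j - (n - 1)))"
    if "j \<notin> {1, 2 - n}" for j
  proof -
    consider "j = n" | "j \<noteq> n" by blast
    then show ?thesis
      by cases (use that n l N0 ne in \<open>simp_all add: fun_eq_iff witt_dual_bracket_def Let_def val
          fscale_apply nN\<close>, (simp add: field_simps power2_eq_square)+)
  qed
  have 3: "?E n j = fscale (k * of_int (j + 2 * n - 3) / (2 * (of_int n - 1))) (witt_eps (j + n - 1))
          + fscale (k * l / 2 * of_int (1 - j)) (witt_eps j)" if "j \<notin> {1, 2 - n, n}" for j
    using that n l N0 ne
    by (simp add: fun_eq_iff witt_dual_bracket_def Let_def val fscale_apply nN)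
      (simp add: field_simps power2_eq_square)
  have 4: "?E i j = 0" if "i \<notin> {1, 2 - n, n} \<and> j \<notin> {1, 2 - n, n}" for i j
    using that by (simp add: fun_eq_iff witt_dual_bracket_def Let_def val)
  show ?thesis
    unfolding eps_bracket_table_def
    by (intro conjI allI impI) (rule 0 1 2 3 4, assumption?)+
qed

lemma eps_bracket_table_pullback:
  assumes "eps_bracket_table eps n l k E"
  shows "eps_bracket_table (\<lambda>i u. eps i (\<pi> u)) n l k (\<lambda>i j u. E i j (\<pi> u))"
  using assms
  unfolding eps_bracket_table_def fun_eq_iff fscale_apply plus_fun_apply minus_apply uminus_apply
    zero_fun_apply
  by blast

lemma bracket_description_pullback:
  fixes l k :: "'f::field_char_0"
  assumes n: "n \<noteq> 1" and l: "l \<noteq> 0"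
    and \<delta>: "\<And>f g. f \<in> full_dual witt_scale \<Longrightarrow> g \<in> full_dual witt_scale \<Longrightarrow>
      dual_bracket \<delta> (\<lambda>u. f (\<pi> u)) (\<lambda>u. g (\<pi> u)) = (\<lambda>u. witt_dual_bracket n l k f g (\<pi> u))"
  shows "bracket_description \<delta> (\<lambda>i u. witt_eps i (\<pi> u)) n l k"
proof -
  define X where "X = elem_X witt_scale witt_x n l"
  define Y where "Y = elem_Y witt_scale witt_x n l k"
  define E where "E = (\<lambda>i j. witt_dual_bracket n l k (witt_eps i) (witt_eps j))"
  have E: "E i j p = witt_eps i (witt_bracket p X) * witt_eps j Y + witt_eps i X * witt_eps j (witt_bracket p Y)
      - witt_eps i (witt_bracket p Y) * witt_eps j X - witt_eps i Y * witt_eps j (witt_bracket p X)" for i j p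
    by (simp add: E_def witt_dual_bracket_def Let_def X_def Y_def)
  \<comment> \<open>For fixed \<open>p\<close>, the bracket evaluates its functionals only at these
    four Laurent polynomials, so the double series is a finite sum over
    \<open>A p \<times> A p\<close>.\<close>
  define A where "A = (\<lambda>p. Poly_Mapping.keys X \<union> Poly_Mapping.keys Y
    \<union> Poly_Mapping.keys (witt_bracket p X) \<union> Poly_Mapping.keys (witt_bracket p Y))"
  have fin: "finite (A p)" for p by (simp add: A_def)
  have supp: "i \<in> A p \<and> j \<in> A p" if "E i j p \<noteq> 0" for i j p
    using that by (auto simp: E A_def witt_eps_def in_keys_iff)
  have eps_sum: "eps_sum witt_eps a q = (\<Sum>i\<in>A p. a i * witt_eps i q)"
    if "q \<in> {X, Y, witt_bracket p X, witt_bracket p Y}" for a p q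
  proof -
    have "Poly_Mapping.keys q \<subseteq> A p" using that by (auto simp: A_def)
    from eps_sum_witt[OF fin this, of a] show ?thesis by (simp only: witt_eps_def[of _ q])
  qed
  have "witt_dual_bracket n l k (eps_sum witt_eps a) (eps_sum witt_eps b) p
      = Sum_any (\<lambda>(i, j). a i * b j * E i j p)" for a b p
  proof -
    have "Sum_any (\<lambda>(i, j). a i * b j * E i j p) = (\<Sum>(i, j)\<in>A p \<times> A p. a i * b j * E i j p)"
      by (rule Sum_any.expand_superset) (use fin supp in auto)
    also have "\<dots> = (\<Sum>i\<in>A p. \<Sum>j\<in>A p. a i * b j * E i j p)"
      by (simp add: sum.cartesian_product)
    also have "\<dots> = witt_dual_bracket n l k (eps_sum witt_eps a) (eps_sum witt_eps b) p"
      unfolding witt_dual_bracket_def Let_def X_def[symmetric] Y_def[symmetric]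
      by (simp only: eps_sum[of _ p] insert_iff simp_thms sum_product)
        (simp add: E right_diff_distrib distrib_left sum.distrib sum_subtractf mult_ac)
    finally show ?thesis ..
  qed
  moreover have "finite {(i, j). E i j p \<noteq> 0}" for p
    by (rule finite_subset[of _ "A p \<times> A p"]) (use fin supp in auto)
  moreover have "eps_bracket_table (\<lambda>i u. witt_eps i (\<pi> u)) n l k (\<lambda>i j u. E i j (\<pi> u))"
    unfolding E_def by (rule eps_bracket_table_pullback[OF eps_bracket_table_witt[OF n l]])
  ultimately show ?thesis
    by (simp add: bracket_description_def eps_sum_pullback[of \<pi>] \<delta> witt_eps_full_dual
        eps_sum_full_dual E_def)
qed

lemma fst_elem:
  "fst (elem_X vir_scale vir_x n l) = elem_X witt_scale witt_x n l"
  "fst (elem_Y vir_scale vir_x n l k) = elem_Y witt_scale witt_x n l k"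
  by (simp_all add: elem_X_def elem_Y_def vir_scale_def vir_x_def)

text \<open>The first component of the Virasoro identity; the central term disappears under the
  projection.\<close>

lemma witt_bracket_X_Y:
  fixes l k :: "'f::field_char_0"
  assumes "n \<noteq> 1" "l \<noteq> 0"
  shows "witt_bracket (elem_X witt_scale witt_x n l) (elem_Y witt_scale witt_x n l k)
    = elem_Y witt_scale witt_x n l k"
  using arg_cong[OF vir_bracket_X_Y[OF assms, of k], of fst]
  by (simp add: vir_bracket_def fst_elem)

theorem theorem4p9:
  fixes n :: int and l k :: "'f :: {alg_closed_field, field_char_0}"
  assumes "n \<noteq> 1" and "l \<noteq> 0" and "k \<noteq> 0"
  shows
    "(triangular_lie_bialgebra witt_scale UNIV witt_bracket (witt_delta n l k)
        (r_matrix witt_scale witt_x n l k) \<and>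
      lie_bialgebra fscale (lie_dual (witt_scale :: 'f \<Rightarrow> _) witt_bracket)
        (dual_bracket (witt_delta n l k)) (dual_cobracket witt_scale witt_bracket) \<and>
      lie_dual (witt_scale :: 'f \<Rightarrow> _) witt_bracket
        = {eps_sum witt_eps a | a. linearly_recursive a} \<and>
      cobracket_description (witt_scale :: 'f \<Rightarrow> _) witt_bracket witt_eps \<and>
      bracket_description (witt_delta n l k) witt_eps n l k)
     \<and>
     ((n = 0 \<or> n = 2 \<longrightarrow>
         triangular_lie_bialgebra vir_scale UNIV vir_bracket (vir_delta n l k)
           (r_matrix vir_scale vir_x n l k)) \<and>
      lie_bialgebra fscale (lie_dual (vir_scale :: 'f \<Rightarrow> _) vir_bracket)
        (dual_bracket (vir_delta n l k)) (dual_cobracket vir_scale vir_bracket) \<and>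
      lie_dual (vir_scale :: 'f \<Rightarrow> _) vir_bracket
        = {eps_sum vir_eps a | a. linearly_recursive a} \<and>
      cobracket_description (vir_scale :: 'f \<Rightarrow> _) vir_bracket vir_eps \<and>
      bracket_description (vir_delta n l k) vir_eps n l k)"
proof -
  let ?X = "elem_X witt_scale witt_x n l" and ?Y = "elem_Y witt_scale witt_x n l k"
  let ?X' = "elem_X vir_scale vir_x n l" and ?Y' = "elem_Y vir_scale vir_x n l k"
  interpret W: lie_alg_r witt_scale witt_bracket ?X ?Y
    by unfold_locales (rule lie_algebra_witt)
  interpret Vir: lie_alg_r vir_scale vir_bracket ?X' ?Y'
    by unfold_locales (rule lie_algebra_vir)
  have r: "W.r_mat = r_matrix witt_scale witt_x n l k" "Vir.r_mat = r_matrix vir_scale vir_x n l k"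
    by (simp_all add: W.r_mat_def Vir.r_mat_def r_matrix_def)
  have \<delta>: "W.delta = witt_delta n l k" "Vir.delta = vir_delta n l k"
    by (simp_all add: fun_eq_iff W.delta_def Vir.delta_def witt_delta_def vir_delta_def r)
  have eps: "vir_eps = (\<lambda>i (u :: 'f virasoro). witt_eps i (fst u))"
    by (simp add: fun_eq_iff vir_eps_def)
  note XY = witt_bracket_X_Y[OF assms(1,2), of k]
  have "triangular_lie_bialgebra witt_scale UNIV witt_bracket (witt_delta n l k)
      (r_matrix witt_scale witt_x n l k)"
    using W.triangular_lie_bialgebra_delta[OF XY] by (simp only: r \<delta>)
  moreover have "lie_bialgebra fscale (lie_dual (witt_scale :: 'f \<Rightarrow> _) witt_bracket)
      (dual_bracket (witt_delta n l k)) (dual_cobracket witt_scale witt_bracket)"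
    using W.dual_lie_bialgebra by (simp only: XY \<delta>)
  moreover have "cobracket_description (witt_scale :: 'f \<Rightarrow> _) witt_bracket witt_eps"
    by (rule cobracket_description_pullback[OF lie_algebra_witt, of "\<lambda>p. p"])
      (simp_all add: lie_dual_witt)
  moreover have "bracket_description (witt_delta n l k) witt_eps n l k"
    by (rule bracket_description_pullback[OF assms(1,2), where \<pi> = "\<lambda>p. p"])
      (simp add: fun_eq_iff W.dual_bracket_apply[unfolded \<delta>] witt_dual_bracket_def Let_def)
  moreover have "triangular_lie_bialgebra vir_scale UNIV vir_bracket (vir_delta n l k)
      (r_matrix vir_scale vir_x n l k)" if "n = 0 \<or> n = 2"
  proof -
    \<comment> \<open>The central term of the bracket is a multiple of
      \<open>n (n - 2)\<close>.\<close>
    have "vir_bracket ?X' ?Y' = ?Y'"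
      using vir_bracket_X_Y[OF assms(1,2), of k] that by (auto simp: zero_prod_def[symmetric])
    from Vir.triangular_lie_bialgebra_delta[OF this] show ?thesis by (simp only: r \<delta>)
  qed
  moreover have "lie_bialgebra fscale (lie_dual (vir_scale :: 'f \<Rightarrow> _) vir_bracket)
      (dual_bracket (vir_delta n l k)) (dual_cobracket vir_scale vir_bracket)"
    unfolding \<delta>[symmetric]
    \<comment> \<open>Every functional in the dual factors through \<open>fst\<close>, where
      \<open>[X, Y] = Y\<close> holds for all admissible \<open>n\<close>.\<close>
    by (rule Vir.dual_lie_bialgebra) (auto simp: lie_dual_vir vir_bracket_def fst_elem XY)
  moreover have "cobracket_description (vir_scale :: 'f \<Rightarrow> _) vir_bracket vir_eps"
    unfolding eps
    by (rule cobracket_description_pullback[OF lie_algebra_vir])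
      (simp_all add: lie_dual_vir vir_bracket_def)
  moreover have "bracket_description (vir_delta n l k) vir_eps n l k"
  proof -
    have "(\<lambda>u. f (fst u)) \<in> full_dual vir_scale" if "f \<in> full_dual witt_scale" for f :: "'f witt \<Rightarrow> 'f"
      using that by (simp add: full_dual_vir full_dual_witt vir_scale_def)
    then show ?thesis
      unfolding eps
      by (intro bracket_description_pullback[OF assms(1,2)])
        (simp add: fun_eq_iff Vir.dual_bracket_apply[unfolded \<delta>] witt_dual_bracket_def Let_def
          vir_bracket_def fst_elem)
  qed
  ultimately show ?thesis
    by (auto simp: lie_dual_witt lie_dual_vir ideal_dual_eq eps_sum_vir)
qed

end
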